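(* There exists an absolute constant $\alpha>0$ such that for every integer $m\ge 2$ with $m\notin\left\{\binom n2+1,\ \binom n2+2 : n\ge 2\right\}$ (where $n$ ranges over integers) we have $\psi(m)\ge (1+\alpha)\sqrt{2m}$.
   Context: For a set $X$, $X^{(2)}$ denotes the set of 2-element subsets of $X$ (the edges of the complete graph on vertex set $X$). An $m$-colouring of $\mathbb N^{(2)}$ is a surjective map $\Delta:\mathbb N^{(2)}\to[m]=\{1,\dots,m\}$. For $X\subset\mathbb N$ put $\gamma_\Delta(X)=|\Delta(X^{(2)})|$, the number of colours appearing on edges inside $X$, and let $\mathcal F_\Delta=\{\gamma_\Delta(X): X\subset\mathbb N,\ X\text{ infinite}\}$. Define $\psi(m)=\min_\Delta|\mathcal F_\Delta|$, the minimum being over all $m$-colourings $\Delta$ of $\mathbb N^{(2)}$. *)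

theory Defs
  imports Complex_Main "HOL-Library.Ramsey"
begin

text \<open>
  The set of 2-element subsets of \<open>X\<close> is \<open>[X]\<^bsup>2\<^esup>\<close>, i.e. \<open>nsets X 2\<close>.
  A colouring is a total function on \<open>nat set\<close>; only its values on 2-element sets matter.
\<close>

definition colouring :: "nat \<Rightarrow> (nat set \<Rightarrow> nat) \<Rightarrow> bool" where
  "colouring m \<Delta> \<longleftrightarrow> \<Delta> ` [UNIV]\<^bsup>2\<^esup> = {1..m}"

definition num_colours :: "(nat set \<Rightarrow> nat) \<Rightarrow> nat set \<Rightarrow> nat" where
  "num_colours \<Delta> X = card (\<Delta> ` [X]\<^bsup>2\<^esup>)"

definition colour_counts :: "(nat set \<Rightarrow> nat) \<Rightarrow> nat set" where
  "colour_counts \<Delta> = {num_colours \<Delta> X |X. infinite X}"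

definition psi :: "nat \<Rightarrow> nat" where
  "psi m = Min {card (colour_counts \<Delta>) |\<Delta>. colouring m \<Delta>}"

text \<open>The set under \<open>Min\<close> is finite, and for \<open>m \<ge> 1\<close> nonempty, so the minimum exists.\<close>

lemma colour_counts_subset:
  assumes "colouring m \<Delta>"
  shows "colour_counts \<Delta> \<subseteq> {0..m}"
proof -
  have "num_colours \<Delta> X \<le> m" for X
  proof -
    have "\<Delta> ` [X]\<^bsup>2\<^esup> \<subseteq> {1..m}"
      using assms nsets_mono[of X UNIV 2] unfolding colouring_def by blast
    then show ?thesis
      using card_mono[of "{1..m}" "\<Delta> ` [X]\<^bsup>2\<^esup>"] by (simp add: num_colours_def)
  qed
  then show ?thesis by (auto simp: colour_counts_def)
qed

lemma finite_psi_candidates: "finite {card (colour_counts \<Delta>) |\<Delta>. colouring m \<Delta>}"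
proof (rule finite_subset)
  show "{card (colour_counts \<Delta>) |\<Delta>. colouring m \<Delta>} \<subseteq> {..Suc m}"
    using card_mono[OF _ colour_counts_subset] by fastforce
qed simp

lemma ex_colouring:
  assumes "m \<ge> 1"
  shows "\<exists>\<Delta>. colouring m \<Delta>"
proof
  let ?\<Delta> = "\<lambda>e :: nat set. min m (Max e)"
  have mem: "k \<in> ?\<Delta> ` [UNIV]\<^bsup>2\<^esup>" if "k \<in> {1..m}" for k
    by (rule image_eqI[of _ _ "{0, k}"]) (use that in \<open>auto simp: nsets_def\<close>)
  have pos: "?\<Delta> e \<in> {1..m}" if e: "e \<in> [UNIV]\<^bsup>2\<^esup>" for e
  proof -
    obtain x y where "e = {x, y}" "x \<noteq> y"
      using e unfolding nsets_def card_2_iff by blast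
    then show ?thesis using assms by (auto simp: Suc_le_eq)
  qed
  show "colouring m ?\<Delta>"
    unfolding colouring_def using mem pos by blast
qed

end

theory Submission
  imports Defs
begin

text \<open>
  Choose a finite set \<open>V\<close> on which all colours occur and an infinite set \<open>A\<close>, disjoint from \<open>V\<close>, inside
  which all edges have one colour \<open>b\<close> and such that every \<open>v \<in> V\<close> sends a single colour to \<open>A\<close>. Fixing an
  apex \<open>a \<in> A\<close>, the set \<open>T \<union> A\<close> for \<open>T \<subseteq> V\<close> shows exactly \<open>b\<close> and the colours of the complete graph on
  \<open>T \<union> {a}\<close>, so it suffices to count the values of this finite function \<open>cnt\<close>.

  Removing the vertex of least loss shows that every interval from \<open>(i choose 2) + 2\<close> to
  \<open>(Suc i choose 2) + 1\<close> below \<open>m\<close> contains a value; this already gives about \<open>sqrt (2 * m)\<close> values.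
  If there are hardly more, then some critical set \<open>S\<close> of linear size loses almost \<open>card S\<close> colours at every
  vertex, and \<open>cnt\<close> must be constant on the \<open>k\<close>-subsets of \<open>S\<close> for three consecutive \<open>k\<close>. The second
  difference of \<open>cnt\<close> then forces \<open>S\<close> to be rainbow, with the edges to the apex either essentially
  monochromatic or rainbow too. Take \<open>S\<close> maximal with this structure. Unless \<open>cnt S = m\<close>, which makes \<open>m\<close>
  exceptional, one or two further vertices yield values strictly between those of consecutive subset sizes
  of \<open>S\<close>, for linearly many sizes, and hence too many values.
\<close>

subsection \<open>Colours lost at a vertex\<close>

lemma Suc_choose_two: "Suc n choose 2 = (n choose 2) + n"
  by (simp add: numeral_2_eq_2)

lemma double_choose_two: "2 * (n choose 2) = n * (n - 1)"
  unfolding choose_two by (intro dvd_mult_div_cancel) (cases n, auto)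

lemma double_choose_two_int: "2 * int (n choose 2) = int n * (int n - 1)"
proof -
  have "int (2 * (n choose 2)) = int n * (int n - 1)"
    unfolding double_choose_two by (cases n) (auto simp: algebra_simps)
  then show ?thesis by simp
qed

lemma choose_two_mono: "i \<le> j \<Longrightarrow> i choose 2 \<le> j choose 2"
  by (rule binomial_right_mono)

lemma eq_if_card_Int_interval_le_3:
  fixes w x y z :: nat
  assumes "finite A" "card (A \<inter> {w<..z}) \<le> 3" and "w < x" "x < y" "y < z"
    and "x \<in> A" "y \<in> A" "z \<in> A" "q \<in> A" "w < q" "q \<le> z"
  shows "q = x \<or> q = y \<or> q = z"
proof (rule ccontr)
  assume "\<not> ?thesis"
  moreover have "x \<noteq> y" "y \<noteq> z" "x \<noteq> z" using assms(4,5) by linarith+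
  ultimately have "card {q, x, y, z} = 4" by simp
  moreover have "{q, x, y, z} \<subseteq> A \<inter> {w<..z}" using assms(3-11) by simp
  then have "card {q, x, y, z} \<le> card (A \<inter> {w<..z})" using assms(1) by (intro card_mono) simp_all
  ultimately show False using assms(2) by linarith
qed

locale pointed_colouring =
  fixes \<Delta> :: "'v set \<Rightarrow> 'c" and b :: 'c and a :: 'v and V :: "'v set"
  assumes finite_V: "finite V" and apex: "a \<notin> V"
begin

text \<open>The apex stands for a whole infinite set whose inner edges all have colour
  \<open>b\<close>. Those edges have no counterpart on \<open>insert a T\<close>, so
  \<open>insert b\<close> restores their colour.\<close>

definition palette :: "'v set \<Rightarrow> 'c set" where
  "palette T = insert b (\<Delta> ` [insert a T]\<^bsup>2\<^esup>)"

definition cnt :: "'v set \<Rightarrow> nat" where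
  "cnt T = card (palette T)"

definition star :: "'v \<Rightarrow> 'v set \<Rightarrow> 'c set" where
  "star v T = (\<lambda>x. \<Delta> {v, x}) ` insert a T"

definition loss :: "'v set \<Rightarrow> 'v \<Rightarrow> 'c set" where
  "loss T x = palette T - palette (T - {x})"

definition vals :: "nat set" where
  "vals = cnt ` Pow V"

lemma finite_sub: "T \<subseteq> V \<Longrightarrow> finite T"
  using finite_V finite_subset by blast

lemma sub_apex: "T \<subseteq> V \<Longrightarrow> a \<notin> T"
  using apex by blast

lemma finite_palette [simp]: "finite T \<Longrightarrow> finite (palette T)"
  by (simp add: palette_def finite_imp_finite_nsets)

lemma finite_star [simp]: "finite T \<Longrightarrow> finite (star v T)"
  by (simp add: star_def)

lemma finite_loss [simp]: "finite T \<Longrightarrow> finite (loss T x)"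
  by (simp add: loss_def)

lemma finite_vals: "finite vals"
  by (simp add: vals_def finite_V)

lemma palette_mono: "S \<subseteq> T \<Longrightarrow> palette S \<subseteq> palette T"
  unfolding palette_def by (intro insert_mono image_mono nsets_mono) auto

lemma cnt_mono: "S \<subseteq> T \<Longrightarrow> finite T \<Longrightarrow> cnt S \<le> cnt T"
  unfolding cnt_def by (intro card_mono palette_mono finite_palette)

lemma palette_edge: "x \<in> insert a T \<Longrightarrow> y \<in> insert a T \<Longrightarrow> x \<noteq> y \<Longrightarrow> \<Delta> {x, y} \<in> palette T"
  unfolding palette_def by (intro insertI2 imageI) simp

lemma base_in_palette: "b \<in> palette T"
  by (simp add: palette_def)

lemma palette_cases:
  assumes "c \<in> palette T"
  obtains "c = b" | x y where "x \<in> insert a T" "y \<in> insert a T" "x \<noteq> y" "c = \<Delta> {x, y}"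
  using assms unfolding palette_def nsets_2_eq by blast

lemma palette_insert:
  assumes "v \<notin> insert a T"
  shows "palette (insert v T) = palette T \<union> star v T"
proof
  show "palette (insert v T) \<subseteq> palette T \<union> star v T"
  proof
    fix c assume "c \<in> palette (insert v T)"
    then show "c \<in> palette T \<union> star v T"
    proof (cases rule: palette_cases)
      case 1 then show ?thesis by (simp add: base_in_palette)
    next
      case (2 x y)
      then consider "x \<in> insert a T" "y \<in> insert a T" | "x = v" "y \<in> insert a T" | "y = v" "x \<in> insert a T"
        using assms by auto
      then show ?thesis
      proof cases
        case 1 with 2 show ?thesis using palette_edge by blast
      next
        case 2 with \<open>c = \<Delta> {x, y}\<close> show ?thesis unfolding star_def by blast
      next
        case 3 with \<open>c = \<Delta> {x, y}\<close> show ?thesis unfolding star_def insert_commute[of x] by blast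
      qed
    qed
  qed
  show "palette T \<union> star v T \<subseteq> palette (insert v T)"
    using palette_mono[of T "insert v T"] assms
    by (auto simp: star_def intro!: palette_edge)
qed

lemma palette_remove:
  assumes "x \<in> T" "a \<notin> T"
  shows "palette T = palette (T - {x}) \<union> star x (T - {x})"
  using palette_insert[of x "T - {x}"] assms by (auto simp: insert_absorb)

lemma palette_empty: "palette {} = {b}"
  by (auto simp: palette_def nsets_def card_2_iff)

lemma cnt_empty: "cnt {} = 1"
  by (simp add: cnt_def palette_empty)

lemma loss_subset_star: "x \<in> T \<Longrightarrow> a \<notin> T \<Longrightarrow> loss T x \<subseteq> star x (T - {x})"
  unfolding loss_def using palette_remove by blast

lemma cnt_remove: "x \<in> T \<Longrightarrow> finite T \<Longrightarrow> cnt T = cnt (T - {x}) + card (loss T x)"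
  unfolding cnt_def loss_def
  by (metis Diff_subset card_Diff_subset card_mono finite_palette finite_subset le_add_diff_inverse palette_mono)

lemma card_star_le: "finite T \<Longrightarrow> card (star v T) \<le> Suc (card T)"
  using card_image_le[of "insert a T" "\<lambda>x. \<Delta> {v, x}"] by (auto simp: star_def card_insert_if split: if_splits)

lemma card_loss_le:
  assumes "x \<in> T" "a \<notin> T" "finite T" shows "card (loss T x) \<le> card T"
proof -
  have "card (loss T x) \<le> card (star x (T - {x}))"
    using assms by (intro card_mono loss_subset_star) auto
  also have "\<dots> \<le> Suc (card (T - {x}))" using assms by (intro card_star_le) auto
  also have "\<dots> = card T" using assms by (metis card_Suc_Diff1)
  finally show ?thesis .
qed

lemma cnt_insert_le:
  assumes "v \<notin> insert a T" "finite T" shows "cnt (insert v T) \<le> cnt T + Suc (card T)"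
  unfolding cnt_def palette_insert[OF assms(1)]
  using card_Un_le[of "palette T" "star v T"] card_star_le[OF assms(2), of v] by linarith

lemma cnt_le_choose:
  assumes "finite T" "a \<notin> T" shows "cnt T \<le> (Suc (card T) choose 2) + 1"
  using assms
proof (induction T rule: finite_induct)
  case empty then show ?case by (simp add: cnt_empty)
next
  case (insert v T)
  then have "cnt (insert v T) \<le> cnt T + Suc (card T)" by (intro cnt_insert_le) auto
  with insert show ?case by (simp add: Suc_choose_two)
qed

text \<open>Every colour is lost at no more than two vertices, and at two only if it is the colour of an edge
  avoiding the apex.\<close>

lemma sum_loss_le:
  assumes "finite T" "a \<notin> T"
  shows "(\<Sum>x\<in>T. card (loss T x)) \<le> (cnt T - 1) + card (\<Delta> ` [T]\<^bsup>2\<^esup> \<inter> (palette T - {b}))"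
proof -
  let ?C = "palette T - {b}" and ?E = "\<Delta> ` [T]\<^bsup>2\<^esup>"
  let ?L = "\<lambda>c. {x \<in> T. c \<in> loss T x}"
  have fin: "finite ?C" using assms by simp
  have "(\<Sum>x\<in>T. card (loss T x)) = (\<Sum>x\<in>T. card {c \<in> ?C. c \<in> loss T x})"
  proof (intro sum.cong refl arg_cong[where f=card])
    fix x show "loss T x = {c \<in> ?C. c \<in> loss T x}"
      by (auto simp: loss_def base_in_palette)
  qed
  also have "\<dots> = (\<Sum>c\<in>?C. card (?L c))"
    using assms fin by (intro sum_multicount_gen) auto
  also have "\<dots> \<le> (\<Sum>c\<in>?C. 1 + (if c \<in> ?E then 1 else 0))"
  proof (rule sum_mono)
    fix c assume c: "c \<in> ?C"
    then obtain y z where yz: "y \<in> insert a T" "z \<in> insert a T" "y \<noteq> z" "c = \<Delta> {y, z}"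
      using palette_cases[of c T] by (metis DiffD1 DiffD2 insertI1)
    have sub: "?L c \<subseteq> {y, z} \<inter> T"
    proof
      fix x assume x: "x \<in> ?L c"
      show "x \<in> {y, z} \<inter> T"
      proof (rule ccontr)
        assume "x \<notin> {y, z} \<inter> T"
        with x yz have "c \<in> palette (T - {x})"
          by (simp only: yz(4)) (rule palette_edge, auto)
        with x show False by (simp add: loss_def)
      qed
    qed
    show "card (?L c) \<le> 1 + (if c \<in> ?E then 1 else 0)"
    proof (cases "y \<in> T \<and> z \<in> T")
      case True
      then have "c \<in> ?E" using yz by auto
      moreover have "card (?L c) \<le> card {y, z}" using sub by (intro card_mono) auto
      ultimately show ?thesis using yz(3) by simp
    next
      case False
      then obtain w where "{y, z} \<inter> T \<subseteq> {w}" using yz by auto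
      with sub have "card (?L c) \<le> card {w}" by (intro card_mono) auto
      then show ?thesis by simp
    qed
  qed
  also have "\<dots> = card ?C + card (?C \<inter> ?E)"
    using fin by (simp only: sum.distrib sum.If_cases) (simp add: Int_def)
  also have "card ?C = cnt T - 1" using assms by (simp add: cnt_def base_in_palette)
  finally show ?thesis by (simp add: Int_commute)
qed

lemma sum_loss_le_double:
  assumes "finite T" "a \<notin> T"
  shows "(\<Sum>x\<in>T. card (loss T x)) \<le> 2 * (cnt T - 1)"
proof -
  have "card (\<Delta> ` [T]\<^bsup>2\<^esup> \<inter> (palette T - {b})) \<le> card (palette T - {b})"
    using assms by (intro card_mono) auto
  also have "\<dots> = cnt T - 1" using assms by (simp add: cnt_def base_in_palette)
  finally show ?thesis using sum_loss_le[OF assms] by linarith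
qed

lemma sum_loss_le_choose:
  assumes "finite T" "a \<notin> T"
  shows "(\<Sum>x\<in>T. card (loss T x)) \<le> (cnt T - 1) + (card T choose 2)"
proof -
  have "card (\<Delta> ` [T]\<^bsup>2\<^esup> \<inter> (palette T - {b})) \<le> card (\<Delta> ` [T]\<^bsup>2\<^esup>)"
    using assms by (intro card_mono) (auto simp: finite_imp_finite_nsets)
  also have "\<dots> \<le> card ([T]\<^bsup>2\<^esup>)" using assms by (intro card_image_le finite_imp_finite_nsets)
  also have "\<dots> = card T choose 2" using assms by (simp add: card_nsets)
  finally show ?thesis using sum_loss_le[OF assms] by linarith
qed

section \<open>Critical sets and a value in every binomial interval\<close>

lemma vals_critical:
  assumes "q \<in> vals"
  obtains T where "T \<subseteq> V" "cnt T = q" "\<And>x. x \<in> T \<Longrightarrow> card (loss T x) \<ge> 1"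
    "\<And>x. x \<in> T \<Longrightarrow> q - card (loss T x) \<in> vals"
proof -
  \<comment> \<open>Taking \<open>T\<close> of least size with value \<open>q\<close> makes every
    vertex indispensable: a deletion that kept the value would give a smaller such set.\<close>
  from assms have "\<exists>T. T \<subseteq> V \<and> cnt T = q" by (auto simp: vals_def)
  then obtain T where T: "T \<subseteq> V" "cnt T = q" and min: "\<And>S. S \<subseteq> V \<Longrightarrow> cnt S = q \<Longrightarrow> card T \<le> card S"
    using ex_has_least_nat[of "\<lambda>T. T \<subseteq> V \<and> cnt T = q" _ card] by metis
  have fT: "finite T" using T finite_sub by blast
  show ?thesis
  proof (rule that[OF T])
    fix x assume x: "x \<in> T"
    have eq: "q = cnt (T - {x}) + card (loss T x)" using cnt_remove[OF x fT] T by simp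
    have "cnt (T - {x}) \<noteq> q"
      using min[of "T - {x}"] T x fT card_Diff1_less[OF fT x] by fastforce
    with eq show "card (loss T x) \<ge> 1" by linarith
    show "q - card (loss T x) \<in> vals" using eq T by (auto simp: vals_def)
  qed
qed

text \<open>Averaging over a critical set for \<open>q\<close>: with
  \<open>q = (n choose 2) + 2 + j\<close>, not every vertex can lose \<open>j + n\<close> colours,
  because the losses sum to at most about twice the number of colours. A vertex of smaller loss
  lowers \<open>q\<close> by at most \<open>j + n - 1\<close>, which lands at or above the next
  lower threshold.\<close>

lemma vals_step:
  assumes q: "q \<in> vals" "q \<ge> (n choose 2) + 2" and n: "n \<ge> 2"
  obtains q' where "q' \<in> vals" "q' < q" "q' \<ge> (n - 1 choose 2) + 2"
proof -
  obtain T where T: "T \<subseteq> V" "cnt T = q" "\<And>x. x \<in> T \<Longrightarrow> card (loss T x) \<ge> 1"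
    "\<And>x. x \<in> T \<Longrightarrow> q - card (loss T x) \<in> vals"
    by (rule vals_critical[OF q(1)]) blast
  have fT: "finite T" and aT: "a \<notin> T" using T finite_sub sub_apex by blast+
  obtain n' where n': "n = Suc n'" "n' \<ge> 1" using n by (cases n) auto
  obtain j where j: "q = (n choose 2) + 2 + j" using q(2) le_Suc_ex by blast
  have p: "card T \<ge> n"
  proof (rule ccontr)
    assume "\<not> card T \<ge> n"
    then have "Suc (card T) choose 2 \<le> n choose 2" by (intro choose_two_mono) auto
    then show False using cnt_le_choose[OF fT aT] T(2) q(2) by linarith
  qed
  have "\<exists>x\<in>T. card (loss T x) \<le> j + n'"
  proof (rule ccontr)
    assume "\<not> ?thesis"
    then have "(\<Sum>x\<in>T. j + n) \<le> (\<Sum>x\<in>T. card (loss T x))"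
      by (intro sum_mono) (simp add: n' not_le Suc_leI)
    then have lower: "card T * (j + n) \<le> (\<Sum>x\<in>T. card (loss T x))" by simp
    have dn: "2 * int (n choose 2) = int n * (int n - 1)" by (rule double_choose_two_int)
    show False
    \<comment> \<open>For \<open>card T = n\<close> the bound \<open>2 * (cnt T - 1)\<close> would
      leave \<open>n = 2\<close> open; that at most \<open>n choose 2\<close> colours are lost twice
      is enough.\<close>
    proof (cases "card T = n")
      case True
      have "n * (j + n) \<le> 2 * (n choose 2) + 1 + j"
        using lower sum_loss_le_choose[OF fT aT] T(2) j True by simp
      then have "int (n * (j + n)) \<le> 2 * int (n choose 2) + 1 + int j" by linarith
      then have "int n * int j + int n \<le> 1 + int j"
        unfolding dn by (simp add: algebra_simps)
      moreover have "1 * int j \<le> int n * int j" using n by (intro mult_right_mono) auto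
      ultimately show False using n by linarith
    next
      case False
      with p have "n + 1 \<le> card T" by simp
      then have "(n + 1) * (j + n) \<le> card T * (j + n)" by (rule mult_le_mono1)
      then have "(n + 1) * (j + n) \<le> 2 * (n choose 2) + 2 + 2 * j"
        using lower sum_loss_le_double[OF fT aT] T(2) j by simp
      then have "int ((n + 1) * (j + n)) \<le> 2 * int (n choose 2) + 2 + 2 * int j" by linarith
      then have "int n * int j + 2 * int n \<le> 2 + int j"
        unfolding dn by (simp add: algebra_simps)
      moreover have "1 * int j \<le> int n * int j" using n by (intro mult_right_mono) auto
      ultimately show False using n by linarith
    qed
  qed
  then obtain x where x: "x \<in> T" "card (loss T x) \<le> j + n'" by blast
  have ch: "(n choose 2) = (n' choose 2) + n'" unfolding n' by (rule Suc_choose_two)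
  show ?thesis
  proof (rule that[OF T(4)[OF x(1)]])
    show "q - card (loss T x) < q" using T(3)[OF x(1)] q(2) by simp
    show "q - card (loss T x) \<ge> (n - 1 choose 2) + 2" using x(2) j ch n' by simp
  qed
qed

text \<open>The least value at or above the lower end works: if it overshot the upper end, it would
  reach the threshold for \<open>Suc i\<close>, and \<open>vals_step\<close> would produce a smaller
  value that is still large enough.\<close>

lemma bucket:
  assumes "i \<ge> 1" "(i choose 2) + 2 \<le> cnt V"
  obtains x where "x \<in> vals" "(i choose 2) + 2 \<le> x" "x \<le> (Suc i choose 2) + 1"
proof -
  have ex: "\<exists>x. x \<in> vals \<and> (i choose 2) + 2 \<le> x" using assms(2) by (auto simp: vals_def)
  define x where "x = (LEAST x. x \<in> vals \<and> (i choose 2) + 2 \<le> x)"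
  have x: "x \<in> vals" "(i choose 2) + 2 \<le> x" using LeastI_ex[OF ex] by (auto simp: x_def)
  have "x \<le> (Suc i choose 2) + 1"
  proof (rule ccontr)
    assume "\<not> ?thesis"
    then have "x \<ge> (Suc i choose 2) + 2" by simp
    then obtain q' where "q' \<in> vals" "q' < x" "q' \<ge> (Suc i - 1 choose 2) + 2"
      by (rule vals_step[OF x(1)]) (use assms(1) in auto)
    then show False using not_less_Least[of q' "\<lambda>x. x \<in> vals \<and> (i choose 2) + 2 \<le> x"]
      by (auto simp: x_def)
  qed
  with x that show ?thesis by blast
qed

lemma bucket_choice:
  assumes "(n choose 2) + 2 \<le> cnt V"
  obtains x where "\<And>i. 1 \<le> i \<Longrightarrow> i \<le> n \<Longrightarrow> x i \<in> vals"
    "\<And>i. 1 \<le> i \<Longrightarrow> i \<le> n \<Longrightarrow> (i choose 2) + 2 \<le> x i"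
    "\<And>i. 1 \<le> i \<Longrightarrow> i \<le> n \<Longrightarrow> x i \<le> (Suc i choose 2) + 1"
    "inj_on x {1..n}"
proof -
  have "\<exists>x. x \<in> vals \<and> (i choose 2) + 2 \<le> x \<and> x \<le> (Suc i choose 2) + 1" if "1 \<le> i" "i \<le> n" for i
    by (rule bucket[of i]) (use that assms choose_two_mono[of i n] in auto)
  then obtain x where x: "\<And>i. 1 \<le> i \<Longrightarrow> i \<le> n \<Longrightarrow> x i \<in> vals"
    "\<And>i. 1 \<le> i \<Longrightarrow> i \<le> n \<Longrightarrow> (i choose 2) + 2 \<le> x i"
    "\<And>i. 1 \<le> i \<Longrightarrow> i \<le> n \<Longrightarrow> x i \<le> (Suc i choose 2) + 1" by metis
  have "x i < x j" if "1 \<le> i" "i < j" "j \<le> n" for i j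
    using x(3)[of i] x(2)[of j] that choose_two_mono[of "Suc i" j] by linarith
  then have "inj_on x {1..n}"
    by (intro inj_onI) (metis atLeastAtMost_iff less_irrefl linorder_neqE_nat)
  with x that show ?thesis by blast
qed

text \<open>Replace the representatives \<open>x i\<close> lying in \<open>{lo<..hi}\<close> by all
  values lying there. The binomial intervals at this height have length at least
  \<open>\<nu>\<close>, so at most \<open>2 + (hi - lo) / \<nu>\<close> representatives are
  discarded. Everything is multiplied by \<open>\<nu>\<close> to stay within the naturals.\<close>

lemma vals_gain:
  assumes m: "(n choose 2) + 2 \<le> cnt V" and lo: "lo \<ge> (\<nu> choose 2) + 1" "lo \<le> hi"
  shows "\<nu> * (n + card (vals \<inter> {lo<..hi})) \<le> \<nu> * (card vals + 2) + (hi - lo)"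
proof -
  obtain x where x: "\<And>i. 1 \<le> i \<Longrightarrow> i \<le> n \<Longrightarrow> x i \<in> vals"
    "\<And>i. 1 \<le> i \<Longrightarrow> i \<le> n \<Longrightarrow> (i choose 2) + 2 \<le> x i"
    "\<And>i. 1 \<le> i \<Longrightarrow> i \<le> n \<Longrightarrow> x i \<le> (Suc i choose 2) + 1" "inj_on x {1..n}"
    by (rule bucket_choice[OF m]) blast
  let ?I = "{i \<in> {1..n}. x i \<in> {lo<..hi}}"
  have "card (vals \<inter> {lo<..hi}) + card (x ` ({1..n} - ?I)) = card (vals \<inter> {lo<..hi} \<union> x ` ({1..n} - ?I))"
    using finite_vals by (subst card_Un_disjoint) auto
  also have "\<dots> \<le> card vals" using x finite_vals by (intro card_mono) auto
  also have "card (x ` ({1..n} - ?I)) = card ({1..n} - ?I)"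
    using x(4) by (intro card_image inj_on_subset[OF x(4)]) auto
  also have "\<dots> = n - card ?I" by (subst card_Diff_subset) auto
  finally have total: "n + card (vals \<inter> {lo<..hi}) \<le> card vals + card ?I" by linarith
  have "\<nu> * card ?I \<le> \<nu> * 2 + (hi - lo)"
  proof (cases "?I = {}")
    case False
    define i j where "i = Min ?I" and "j = Max ?I"
    have fin: "finite ?I" by simp
    have i: "i \<in> ?I" and j: "j \<in> ?I" unfolding i_def j_def using False fin Min_in Max_in by blast+
    have ij: "i \<le> j" unfolding i_def j_def using False fin by (intro Min.coboundedI Max_in)
    have "?I \<subseteq> {i..j}" unfolding i_def j_def using fin by auto
    then have cI: "card ?I \<le> Suc j - i" using card_mono[of "{i..j}" ?I] by simp
    have "\<nu> choose 2 < Suc i choose 2" using i lo x(3)[of i] by auto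
    then have \<nu>i: "\<nu> \<le> i" using choose_two_mono[of "Suc i" \<nu>] by (meson leD not_less_eq_eq)
    show ?thesis
    proof (cases "i = j")
      case True
      then have "card ?I \<le> 1" using cI by simp
      then have "\<nu> * card ?I \<le> \<nu> * 2" by (intro mult_le_mono2) linarith
      then show ?thesis by linarith
    next
      case False
      with ij have "Suc i \<le> j" by simp
      then obtain t where t: "j = Suc i + t" using le_Suc_ex by blast
      \<comment> \<open>The \<open>t\<close> intervals with index strictly between \<open>i\<close>
        and \<open>j\<close> fit between \<open>x i\<close> and \<open>x j\<close>, and each has
        length at least \<open>\<nu>\<close>.\<close>
      have step: "(Suc i choose 2) + \<nu> * t \<le> (Suc i + t choose 2)"
      proof (induction t)
        case (Suc t)
        have "\<nu> \<le> Suc i + t" using \<nu>i by simp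
        with Suc show ?case using Suc_choose_two[of "Suc i + t"] by simp
      qed simp
      have "lo < x i" "x i \<le> (Suc i choose 2) + 1" "(Suc i + t choose 2) + 2 \<le> x j" "x j \<le> hi"
        using i j x(2)[of j] x(3)[of i] unfolding t by simp_all
      with step have "\<nu> * t \<le> hi - lo" by linarith
      moreover have "\<nu> * card ?I \<le> \<nu> * (t + 2)" using cI t by (intro mult_le_mono2) simp
      ultimately show ?thesis by (simp add: algebra_simps)
    qed
  next
    case True
    then show ?thesis by (simp only: card.empty)
  qed
  moreover have "\<nu> * (n + card (vals \<inter> {lo<..hi})) \<le> \<nu> * (card vals + card ?I)"
    using total by (rule mult_le_mono2)
  ultimately show ?thesis by (simp add: algebra_simps)
qed

subsection \<open>Sets with few values\<close>

text \<open>Each point \<open>t\<close> above \<open>lo\<close> is covered by the interval of length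
  \<open>s\<close> ending at the least value \<open>q\<close> not below \<open>t\<close>: the value
  that \<open>step\<close> gives below \<open>q\<close> is smaller than \<open>t\<close>, yet at
  distance at most \<open>s\<close> from \<open>q\<close>.\<close>

lemma vals_cover:
  assumes step: "\<And>q. q \<in> vals \<Longrightarrow> lo < q \<Longrightarrow> \<exists>q'\<in>vals. q' < q \<and> q \<le> q' + s"
  shows "cnt V - lo \<le> s * card (vals \<inter> {lo<..cnt V})"
proof -
  have "{lo<..cnt V} \<subseteq> (\<Union>q\<in>vals \<inter> {lo<..cnt V}. {q - s<..q})"
  proof
    fix t assume t: "t \<in> {lo<..cnt V}"
    let ?P = "\<lambda>q. q \<in> vals \<and> t \<le> q"
    define q where "q = (LEAST q. ?P q)"
    have P_V: "?P (cnt V)" using t by (auto simp: vals_def)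
    have q: "?P q" unfolding q_def by (rule LeastI[of ?P, OF P_V])
    have "q \<le> cnt V" unfolding q_def by (rule Least_le[of ?P, OF P_V])
    obtain q' where q': "q' \<in> vals" "q' < q" "q \<le> q' + s" using step[of q] q t by auto
    have "\<not> t \<le> q'" using not_less_Least[of q' ?P] q' by (auto simp: q_def)
    then have "t \<in> {q - s<..q}" using q q' by auto
    moreover have "q \<in> vals \<inter> {lo<..cnt V}" using q t \<open>q \<le> cnt V\<close> by auto
    ultimately show "t \<in> (\<Union>q\<in>vals \<inter> {lo<..cnt V}. {q - s<..q})" by blast
  qed
  then have "card {lo<..cnt V} \<le> card (\<Union>q\<in>vals \<inter> {lo<..cnt V}. {q - s<..q})"
    using finite_vals by (intro card_mono) auto
  also have "\<dots> \<le> (\<Sum>q\<in>vals \<inter> {lo<..cnt V}. card {q - s<..q})"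
    using finite_vals by (intro card_UN_le) auto
  also have "\<dots> \<le> (\<Sum>q\<in>vals \<inter> {lo<..cnt V}. s)" by (intro sum_mono) auto
  finally show ?thesis by (simp add: mult.commute)
qed

end

text \<open>The situation to be shown exceptional: fewer than about \<open>n + y / 1100\<close>
  values. The unit \<open>y\<close>, roughly \<open>n / 1000\<close>, lets sizes and error terms be
  written as integer multiples.\<close>

locale few_values = pointed_colouring \<Delta> b a V
  for \<Delta> :: "'v set \<Rightarrow> 'c" and b :: 'c and a :: 'v and V :: "'v set" +
  fixes n y :: nat
  assumes n_lower: "1000 * y \<le> n" and n_upper: "n < 1000 * y + 1000" and y_large: "y \<ge> 1000"
    and m_lower: "(n choose 2) + 2 \<le> cnt V" and m_upper: "cnt V \<le> (Suc n choose 2) + 1"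
    and few: "1100 * (card vals + 2) < 1100 * n + y"
begin

text \<open>If every value above \<open>lo\<close> had another at most \<open>s\<close> below it,
  there would be a value per length \<open>s\<close>, whereas \<open>vals_gain\<close> charges only
  one interval per length \<open>s + y\<close>; the surplus contradicts \<open>few\<close>. So some
  \<open>q\<close> has no value within \<open>s\<close> below it, and in a critical set for
  \<open>q\<close> each vertex loses more than \<open>s\<close> colours.\<close>

lemma ex_nearly_rainbow:
  obtains S where "S \<subseteq> V" "n + 1 \<le> card S + 2 * y" "\<And>x. x \<in> S \<Longrightarrow> card S \<le> card (loss S x) + 6 * y"
proof -
  define s where "s = n - 2 * y"
  define lo where "lo = (n - y choose 2) + 1"
  let ?K = "card (vals \<inter> {lo<..cnt V})"
  have s: "n - y = s + y" "n = s + 2 * y" "s > 0" using n_lower y_large by (auto simp: s_def)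
  have "(s + y choose 2) + (s + y) * t \<le> (s + y + t choose 2)" for t
  proof (induction t)
    case (Suc t)
    then show ?case using Suc_choose_two[of "s + y + t"] by simp
  qed simp
  from this[of y] have "(s + y choose 2) + (s + y) * y + 2 \<le> cnt V"
    using m_lower s(2) by (simp add: mult_2 add.assoc)
  then have len: "(s + y) * y \<le> cnt V - lo" and "lo \<le> cnt V"
    unfolding lo_def s(1) by linarith+
  have "\<exists>q\<in>vals. lo < q \<and> \<not> (\<exists>q'\<in>vals. q' < q \<and> q \<le> q' + s)"
  proof (rule ccontr)
    assume "\<not> ?thesis"
    then have cover: "cnt V - lo \<le> s * ?K" by (intro vals_cover) blast
    have gain: "(s + y) * (n + ?K) \<le> (s + y) * (card vals + 2) + (cnt V - lo)"
      by (rule vals_gain[OF m_lower _ \<open>lo \<le> cnt V\<close>]) (simp only: lo_def s(1))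
    have "s * y \<le> (s + y) * y" by (intro mult_le_mono1) simp
    with len cover have "s * y \<le> s * ?K" by linarith
    then have K: "y \<le> ?K" using s(3) nat_mult_le_cancel1 by blast
    have "1100 * ((s + y) * (n + ?K)) \<le> (s + y) * (1100 * (card vals + 2)) + 1100 * (s * ?K)"
      using gain cover by (simp add: algebra_simps)
    also have "\<dots> \<le> (s + y) * (1100 * n + y) + 1100 * (s * ?K)"
      using few by (intro add_mono mult_le_mono2) auto
    finally have "y * (1100 * ?K) \<le> y * (s + y)" by (simp add: algebra_simps)
    then have "1100 * ?K \<le> s + y" using y_large by simp
    then show False using K s n_upper y_large by linarith
  qed
  then obtain q where q: "q \<in> vals" "lo < q" "\<And>q'. q' \<in> vals \<Longrightarrow> q' < q \<Longrightarrow> \<not> q \<le> q' + s" by blast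
  obtain T where T: "T \<subseteq> V" "cnt T = q" "\<And>x. x \<in> T \<Longrightarrow> card (loss T x) \<ge> 1"
    "\<And>x. x \<in> T \<Longrightarrow> q - card (loss T x) \<in> vals"
    by (rule vals_critical[OF q(1)]) blast
  have fT: "finite T" and aT: "a \<notin> T" using T finite_sub sub_apex by blast+
  have big: "s + 1 \<le> card (loss T x)" if x: "x \<in> T" for x
  proof -
    have "q - card (loss T x) < q" using T(3)[OF x] q(2) by simp
    from q(3)[OF T(4)[OF x] this] show ?thesis by linarith
  qed
  have "T \<noteq> {}" using T(2) q(2) cnt_empty by (auto simp: lo_def)
  then obtain x where x: "x \<in> T" by blast
  have p1: "s + 1 \<le> card T" using big[OF x] card_loss_le[OF x aT fT] by linarith
  \<comment> \<open>Each colour is lost at most twice, so the total loss is at most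
    \<open>n * (n + 1)\<close>. As each vertex loses more than \<open>s\<close> colours,
    \<open>card T\<close> exceeds \<open>s\<close> by at most \<open>6 * y + 1\<close>.\<close>
  have "card T * (s + 1) = (\<Sum>x\<in>T. s + 1)" by simp
  also have "\<dots> \<le> (\<Sum>x\<in>T. card (loss T x))" by (intro sum_mono big)
  also have "\<dots> \<le> 2 * (cnt T - 1)" by (rule sum_loss_le_double[OF fT aT])
  also have "\<dots> \<le> 2 * (Suc n choose 2)" using cnt_mono[OF T(1) finite_V] m_upper by simp
  also have "\<dots> = Suc n * n" by (simp only: double_choose_two) simp
  finally have up: "card T * (s + 1) \<le> Suc n * n" .
  have p2: "card T \<le> s + 1 + 6 * y"
  proof (rule ccontr)
    assume "\<not> ?thesis"
    then have "(s + 6 * y + 2) * (s + 1) \<le> card T * (s + 1)" by (intro mult_le_mono1) simp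
    with up have "(s + 6 * y + 2) * (s + 1) \<le> Suc (s + 2 * y) * (s + 2 * y)" using s(2) by simp
    then have "2 * (y * s) + 2 * s + 4 * y + 2 \<le> 4 * (y * y)" by (simp add: algebra_simps)
    moreover have "y * (2 * y) \<le> y * s" using n_lower s by (intro mult_le_mono2) linarith
    then have "4 * (y * y) \<le> 2 * (y * s)" by simp
    ultimately show False using y_large by linarith
  qed
  show ?thesis
  proof (rule that[OF T(1)])
    show "n + 1 \<le> card T + 2 * y" using p1 s by linarith
    show "card T \<le> card (loss T x) + 6 * y" if "x \<in> T" for x using big[OF that] p2 by linarith
  qed
qed

text \<open>Otherwise any three consecutive steps of \<open>g\<close> pass at least four values,
  which makes \<open>20 * y\<close> values over \<open>5 * y\<close> blocks of three. Their total
  length is at most \<open>15 * y * (415 * y)\<close>, which accounts for only about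
  \<open>16 * y\<close> binomial intervals, each at least \<open>388 * y\<close> long. The surplus
  contradicts \<open>few\<close>.\<close>

lemma window:
  fixes g :: "nat \<Rightarrow> nat"
  assumes inc: "\<And>k. 400 * y \<le> k \<Longrightarrow> k < 415 * y \<Longrightarrow> g k < g (Suc k)"
    and slow: "\<And>k. 400 * y \<le> k \<Longrightarrow> k < 415 * y \<Longrightarrow> g (Suc k) \<le> g k + Suc k"
    and start: "(388 * y choose 2) + 1 \<le> g (400 * y)"
  shows "\<exists>k\<ge>400 * y. k + 3 \<le> 415 * y \<and> card (vals \<inter> {g k<..g (k + 3)}) \<le> 3"
proof (rule ccontr)
  assume "\<not> ?thesis"
  then have many: "card (vals \<inter> {g k<..g (k + 3)}) \<ge> 4" if "400 * y \<le> k" "k + 3 \<le> 415 * y" for k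
    using that by fastforce
  let ?k = "400 * y"
  have ind: "4 * i \<le> card (vals \<inter> {g ?k<..g (?k + 3 * i)}) \<and> g ?k \<le> g (?k + 3 * i)
     \<and> g (?k + 3 * i) \<le> g ?k + 3 * i * (415 * y)" if "i \<le> 5 * y" for i
    using that
  proof (induction i)
    case (Suc i)
    define k where "k = ?k + 3 * i"
    have k: "400 * y \<le> k" "k + 3 \<le> 415 * y" using Suc.prems by (auto simp: k_def)
    have IH: "4 * i \<le> card (vals \<inter> {g ?k<..g k})" "g ?k \<le> g k" "g k \<le> g ?k + 3 * i * (415 * y)"
      using Suc by (auto simp: k_def)
    have i3: "g k < g (Suc k)" "g (Suc k) < g (Suc (Suc k))" "g (Suc (Suc k)) < g (Suc (Suc (Suc k)))"
      using k by (auto intro!: inc)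
    have s3: "g (Suc k) \<le> g k + 415 * y" "g (Suc (Suc k)) \<le> g (Suc k) + 415 * y"
       "g (Suc (Suc (Suc k))) \<le> g (Suc (Suc k)) + 415 * y"
      using k slow[of k] slow[of "Suc k"] slow[of "Suc (Suc k)"] by auto
    have "vals \<inter> {g ?k<..g (k + 3)} = vals \<inter> {g ?k<..g k} \<union> vals \<inter> {g k<..g (k + 3)}"
      using IH(2) i3 by (auto simp: numeral_3_eq_3)
    then have "card (vals \<inter> {g ?k<..g (k + 3)}) = card (vals \<inter> {g ?k<..g k}) + card (vals \<inter> {g k<..g (k + 3)})"
      using finite_vals by (simp only:) (subst card_Un_disjoint, auto)
    then have "4 * Suc i \<le> card (vals \<inter> {g ?k<..g (k + 3)})" using IH(1) many[OF k] by simp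
    moreover have k3: "k + 3 = Suc (Suc (Suc k))" by simp
    have "g ?k \<le> g (k + 3)" unfolding k3 using IH(2) i3 by linarith
    moreover have "g (k + 3) \<le> g ?k + (3 * i * (415 * y) + 3 * (415 * y))"
      unfolding k3 using IH(3) s3 by linarith
    then have "g (k + 3) \<le> g ?k + 3 * Suc i * (415 * y)" by (simp add: algebra_simps)
    moreover have "?k + 3 * Suc i = k + 3" by (simp add: k_def)
    ultimately show ?case by (simp only:)
  qed simp
  let ?hi = "g (?k + 3 * (5 * y))"
  define K where "K = card (vals \<inter> {g ?k<..?hi})"
  have K: "20 * y \<le> K" and le: "g ?k \<le> ?hi" and len: "?hi - g ?k \<le> 15 * y * (415 * y)"
    using ind[of "5 * y"] by (auto simp: K_def)
  have "388 * y * (n + K) \<le> 388 * y * (card vals + 2) + (?hi - g ?k)"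
    unfolding K_def by (rule vals_gain[OF m_lower start le])
  then have "y * (388 * (n + K)) \<le> y * (388 * (card vals + 2) + 15 * (415 * y))"
    using len by (simp add: algebra_simps)
  then have "388 * (n + K) \<le> 388 * (card vals + 2) + 15 * (415 * y)" using y_large by simp
  then have "1100 * (388 * (n + K)) \<le> 388 * (1100 * (card vals + 2)) + 1100 * (15 * (415 * y))"
    by simp
  also have "388 * (1100 * (card vals + 2)) \<le> 388 * (1100 * n + y)"
    using few by (intro mult_le_mono2) simp
  finally have "426800 * K \<le> 6847888 * y" by simp
  then show False using K y_large by linarith
qed

end

section \<open>Hereditary deficits and the largest counts of each size\<close>

context pointed_colouring
begin

text \<open>A colour lost at \<open>x\<close> in \<open>S\<close> and carried by an edge from
  \<open>x\<close> into \<open>insert a T\<close> is still lost in \<open>T\<close>. What disappears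
  comes from edges to \<open>S - T\<close>, so the loss drops by no more than the size does.\<close>

lemma loss_restrict:
  assumes S: "finite S" "a \<notin> S" and T: "T \<subseteq> S" "x \<in> T" and e: "card S \<le> card (loss S x) + e"
  shows "card T \<le> card (loss T x) + e"
proof -
  have fT: "finite T" using S T finite_subset by blast
  have "loss S x \<subseteq> loss T x \<union> (\<lambda>z. \<Delta> {x, z}) ` (S - T)"
  proof
    fix c assume c: "c \<in> loss S x"
    then have "c \<in> star x (S - {x})" using loss_subset_star S T by blast
    then obtain z where z: "z \<in> insert a (S - {x})" "c = \<Delta> {x, z}" by (auto simp: star_def)
    have "c \<notin> palette (T - {x})" using c palette_mono[of "T - {x}" "S - {x}"] T by (auto simp: loss_def)
    moreover have "c \<in> palette T" if "z \<notin> S - T"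
      unfolding z(2) using that z(1) T S by (intro palette_edge) auto
    ultimately show "c \<in> loss T x \<union> (\<lambda>z. \<Delta> {x, z}) ` (S - T)" using z by (auto simp: loss_def)
  qed
  then have "card (loss S x) \<le> card (loss T x \<union> (\<lambda>z. \<Delta> {x, z}) ` (S - T))"
    using S fT by (intro card_mono) auto
  also have "\<dots> \<le> card (loss T x) + card ((\<lambda>z. \<Delta> {x, z}) ` (S - T))" by (rule card_Un_le)
  also have "\<dots> \<le> card (loss T x) + (card S - card T)"
    using S fT T card_image_le[of "S - T" "\<lambda>z. \<Delta> {x, z}"] by (simp add: card_Diff_subset)
  finally show ?thesis using e card_mono[OF S(1) T(1)] by linarith
qed

end

locale nearly_rainbow = pointed_colouring \<Delta> b a V
  for \<Delta> :: "'v set \<Rightarrow> 'c" and b :: 'c and a :: 'v and V :: "'v set" +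
  fixes S :: "'v set" and e :: nat
  assumes S_sub: "S \<subseteq> V" and loss_large: "x \<in> S \<Longrightarrow> card S \<le> card (loss S x) + e"
begin

lemma finite_S: "finite S" and apex_S: "a \<notin> S"
  using S_sub finite_sub sub_apex by blast+

lemma finite_T: "T \<subseteq> S \<Longrightarrow> finite T"
  using finite_S finite_subset by blast

lemma loss_large_sub: "T \<subseteq> S \<Longrightarrow> x \<in> T \<Longrightarrow> card T \<le> card (loss T x) + e"
  using loss_restrict[OF finite_S apex_S] loss_large by blast

lemma cnt_insert_bounds:
  assumes "T \<subseteq> S" "v \<in> S" "v \<notin> T"
  shows "cnt (insert v T) \<le> cnt T + Suc (card T)" "cnt T + Suc (card T) \<le> cnt (insert v T) + e"
proof -
  have fT: "finite T" using assms finite_T by blast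
  show "cnt (insert v T) \<le> cnt T + Suc (card T)"
    using assms fT apex_S by (intro cnt_insert_le) auto
  have "cnt (insert v T) = cnt T + card (loss (insert v T) v)"
    using cnt_remove[of v "insert v T"] fT assms by simp
  moreover have "card (insert v T) \<le> card (loss (insert v T) v) + e"
    using assms by (intro loss_large_sub) auto
  ultimately show "cnt T + Suc (card T) \<le> cnt (insert v T) + e" using fT assms by simp
qed

text \<open>Plays the role of the sequence \<open>g\<close> in \<open>window\<close>:
  \<open>cnt\<close> may still vary over the \<open>k\<close>-subsets, but its maximum is itself a
  value and grows in a controlled way with \<open>k\<close>.\<close>

definition maxcnt :: "nat \<Rightarrow> nat" where
  "maxcnt k = Max (cnt ` {T. T \<subseteq> S \<and> card T = k})"

lemma maxcnt_ge: "T \<subseteq> S \<Longrightarrow> cnt T \<le> maxcnt (card T)"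
  unfolding maxcnt_def using finite_S by (intro Max_ge) auto

lemma maxcnt_attained:
  assumes "k \<le> card S" obtains T where "T \<subseteq> S" "card T = k" "cnt T = maxcnt k"
proof -
  have "maxcnt k \<in> cnt ` {T. T \<subseteq> S \<and> card T = k}"
    unfolding maxcnt_def
  proof (rule Max_in)
    show "finite (cnt ` {T. T \<subseteq> S \<and> card T = k})" using finite_S by simp
    show "cnt ` {T. T \<subseteq> S \<and> card T = k} \<noteq> {}" using obtain_subset_with_card_n[OF assms] by blast
  qed
  with that show ?thesis by auto
qed

lemma maxcnt_vals: "k \<le> card S \<Longrightarrow> maxcnt k \<in> vals"
  using maxcnt_attained[of k] S_sub unfolding vals_def by (metis PowI imageI order_trans)

text \<open>Delete a vertex from a maximiser of size \<open>Suc k\<close> for the upper bound, and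
  add one to a maximiser of size \<open>k\<close> for the lower.\<close>

lemma maxcnt_Suc:
  assumes "k < card S" shows "maxcnt (Suc k) \<le> maxcnt k + Suc k" "maxcnt k + Suc k \<le> maxcnt (Suc k) + e"
proof -
  obtain T where T: "T \<subseteq> S" "card T = Suc k" "cnt T = maxcnt (Suc k)"
    by (rule maxcnt_attained[of "Suc k"]) (use assms in auto)
  then obtain v where v: "v \<in> T" by fastforce
  have "card (T - {v}) = k" using T v by simp
  moreover have "cnt (insert v (T - {v})) \<le> cnt (T - {v}) + Suc (card (T - {v}))"
    using T v by (intro cnt_insert_bounds) auto
  moreover have "cnt (T - {v}) \<le> maxcnt (card (T - {v}))" using T by (intro maxcnt_ge) auto
  ultimately show "maxcnt (Suc k) \<le> maxcnt k + Suc k" using T v by (simp add: insert_absorb)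
  obtain T where T: "T \<subseteq> S" "card T = k" "cnt T = maxcnt k"
    by (rule maxcnt_attained[of k]) (use assms in auto)
  then obtain v where v: "v \<in> S" "v \<notin> T" using assms by (metis less_irrefl subsetI subset_antisym)
  have "card (insert v T) = Suc k" using T v finite_T by simp
  then have "cnt (insert v T) \<le> maxcnt (Suc k)" using maxcnt_ge[of "insert v T"] T v by simp
  then show "maxcnt k + Suc k \<le> maxcnt (Suc k) + e" using cnt_insert_bounds(2)[OF T(1) v] T by simp
qed

lemma maxcnt_lower: "k \<le> card S \<Longrightarrow> (Suc k choose 2) + 1 \<le> maxcnt k + e * k"
proof (induction k)
  case 0
  have "cnt {} \<le> maxcnt (card ({} :: 'v set))" by (rule maxcnt_ge) simp
  then show ?case by (simp add: cnt_empty numeral_2_eq_2)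
next
  case (Suc k)
  then show ?case using maxcnt_Suc(2)[of k] Suc_choose_two[of "Suc k"] by simp
qed

text \<open>Exchanging one vertex changes the number of colours by at most \<open>e\<close>, so walking from a maximiser to a
  non-maximiser meets a value just below the maximum.\<close>

lemma nonconstant_vals:
  assumes "T \<subseteq> S" "cnt T = maxcnt (card T)" "T' \<subseteq> S" "card T' = card T" "cnt T' \<noteq> maxcnt (card T)"
  shows "\<exists>q\<in>vals. q < maxcnt (card T) \<and> maxcnt (card T) \<le> q + e"
  using assms
proof (induction "card (T - T')" arbitrary: T rule: less_induct)
  case less
  have fT: "finite T" "finite T'" using less finite_T by blast+
  have "T \<noteq> T'" using less by auto
  then have "\<not> T \<subseteq> T'" "\<not> T' \<subseteq> T" using fT less.prems(4) by (metis card_subset_eq)+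
  then obtain u v where u: "u \<in> T" "u \<notin> T'" and v: "v \<in> T'" "v \<notin> T" by blast
  let ?T = "insert v (T - {u})"
  have c: "Suc (card (T - {u})) = card T" using fT u by (intro card.remove[symmetric])
  have cT: "card ?T = card T" using fT u v c by simp
  have sub: "?T \<subseteq> S" "T - {u} \<subseteq> S" using less.prems v by auto
  have "cnt T \<le> cnt (T - {u}) + card T"
    using cnt_insert_bounds(1)[of "T - {u}" u] less.prems u c by (auto simp: insert_absorb)
  moreover have "cnt (T - {u}) + card T \<le> cnt ?T + e"
    using cnt_insert_bounds(2)[of "T - {u}" v] less.prems v c by auto
  ultimately have near: "maxcnt (card T) \<le> cnt ?T + e" using less.prems(2) by linarith
  have "cnt ?T \<le> maxcnt (card T)" using maxcnt_ge[OF sub(1)] cT by simp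
  show ?case
  proof (cases "cnt ?T = maxcnt (card T)")
    case True
    have "?T - T' \<subset> T - T'" using u v by auto
    then have "card (?T - T') < card (T - T')" using fT by (intro psubset_card_mono) auto
    then show ?thesis using less.hyps[of ?T] sub less.prems True cT by auto
  next
    case False
    have "cnt ?T \<in> vals" using sub S_sub unfolding vals_def by blast
    with False show ?thesis using near \<open>cnt ?T \<le> _\<close> by (meson le_neq_implies_less)
  qed
qed

text \<open>The three maxima already use up the three values allowed in the window. Since
  \<open>2 * e < k\<close>, consecutive maxima differ by more than \<open>e\<close>, so the value
  that \<open>nonconstant_vals\<close> finds within \<open>e\<close> below one of them would be a
  fourth.\<close>

lemma window_constant:
  assumes k: "2 * e < k" "k + 3 \<le> card S" and few: "card (vals \<inter> {maxcnt k<..maxcnt (k + 3)}) \<le> 3"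
    and T: "T \<subseteq> S" "k < card T" "card T \<le> k + 3"
  shows "cnt T = maxcnt (card T)"
proof (rule ccontr)
  assume ne: "cnt T \<noteq> maxcnt (card T)"
  obtain T0 where T0: "T0 \<subseteq> S" "card T0 = card T" "cnt T0 = maxcnt (card T)"
    by (rule maxcnt_attained[of "card T"]) (use k T in auto)
  obtain q where q: "q \<in> vals" "q < maxcnt (card T)" "maxcnt (card T) \<le> q + e"
    using nonconstant_vals[OF T0(1) _ T(1)] T0(2,3) ne by metis
  have jump: "maxcnt j + e < maxcnt (Suc j)" if "k \<le> j" "j < k + 3" for j
    using maxcnt_Suc(2)[of j] that k by linarith
  have j: "maxcnt k + e < maxcnt (k + 1)" "maxcnt (k + 1) + e < maxcnt (k + 2)" "maxcnt (k + 2) + e < maxcnt (k + 3)"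
    using jump[of k] jump[of "k + 1"] jump[of "k + 2"] by (simp_all add: numeral_3_eq_3)
  have "card T = k + 1 \<or> card T = k + 2 \<or> card T = k + 3" using T by linarith
  then have pos: "maxcnt k < q" "q \<le> maxcnt (k + 3)"
    and ne3: "\<not> (q = maxcnt (k + 1) \<or> q = maxcnt (k + 2) \<or> q = maxcnt (k + 3))"
    using q j by (elim disjE; simp only: simp_thms; linarith)+
  have in_vals: "maxcnt (k + 1) \<in> vals" "maxcnt (k + 2) \<in> vals" "maxcnt (k + 3) \<in> vals"
    using k(2) by (simp_all add: maxcnt_vals)
  have inc: "maxcnt k < maxcnt (k + 1)" "maxcnt (k + 1) < maxcnt (k + 2)" "maxcnt (k + 2) < maxcnt (k + 3)"
    using j by linarith+
  show False using eq_if_card_Int_interval_le_3[OF finite_vals few inc in_vals q(1) pos] ne3 by contradiction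
qed

end

subsection \<open>Second differences\<close>

text \<open>Inclusion-exclusion for \<open>A \<union> B\<close> and \<open>A \<union> C\<close>. In
  the application \<open>A\<close> is the palette of \<open>T\<close>, \<open>B\<close> and
  \<open>C\<close> are the stars of two further vertices, and \<open>c\<close> is the colour of the
  edge joining them.\<close>

lemma card_insert_Un_eq_iff:
  assumes "finite A" "finite B" "finite C"
  shows "card (insert c (A \<union> B \<union> C)) + card A = card (A \<union> B) + card (A \<union> C) + 1
    \<longleftrightarrow> c \<notin> A \<union> B \<union> C \<and> B \<inter> C \<subseteq> A"
proof -
  have "(A \<union> B) \<union> (A \<union> C) = A \<union> B \<union> C" "(A \<union> B) \<inter> (A \<union> C) = A \<union> (B \<inter> C)" by auto
  then have eq: "card (A \<union> B) + card (A \<union> C) = card (A \<union> B \<union> C) + card (A \<union> (B \<inter> C))"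
    using card_Un_Int[of "A \<union> B" "A \<union> C"] assms by simp
  have "card A \<le> card (A \<union> (B \<inter> C))" using assms by (intro card_mono) auto
  moreover have "card A = card (A \<union> (B \<inter> C)) \<longleftrightarrow> B \<inter> C \<subseteq> A"
  proof
    assume "card A = card (A \<union> (B \<inter> C))"
    then have "A = A \<union> (B \<inter> C)" using assms by (intro card_subset_eq) auto
    then show "B \<inter> C \<subseteq> A" by blast
  qed (simp add: Un_absorb2)
  moreover have "card (insert c (A \<union> B \<union> C)) = card (A \<union> B \<union> C) + (if c \<in> A \<union> B \<union> C then 0 else 1)"
    using assms by (auto simp: insert_absorb)
  ultimately show ?thesis using eq by (cases "c \<in> A \<union> B \<union> C") auto
qed

context pointed_colouring
begin

text \<open>Says that the second difference of \<open>cnt\<close> at \<open>T\<close> in the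
  directions \<open>u\<close> and \<open>v\<close> takes its largest possible value, 1; see
  \<open>free_pair_iff\<close>.\<close>

definition free_pair :: "'v set \<Rightarrow> 'v \<Rightarrow> 'v \<Rightarrow> bool" where
  "free_pair T u v \<longleftrightarrow> \<Delta> {u, v} \<notin> palette T \<union> star u T \<union> star v T \<and> star u T \<inter> star v T \<subseteq> palette T"

lemma star_insert: "star u (insert v T) = insert (\<Delta> {u, v}) (star u T)"
  by (auto simp: star_def)

lemma free_pair_iff:
  assumes "finite T" "u \<notin> insert a T" "v \<notin> insert a T" "u \<noteq> v"
  shows "free_pair T u v \<longleftrightarrow>
    cnt (insert u (insert v T)) + cnt T = cnt (insert u T) + cnt (insert v T) + 1"
proof -
  have "palette (insert u (insert v T)) = insert (\<Delta> {u, v}) (palette T \<union> star u T \<union> star v T)"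
    using assms by (subst palette_insert) (auto simp: palette_insert star_insert)
  then show ?thesis
    unfolding free_pair_def cnt_def using assms
    by (simp only: palette_insert[OF assms(2)] palette_insert[OF assms(3)]
        card_insert_Un_eq_iff[OF finite_palette finite_star finite_star])
qed

definition spoke :: "'v \<Rightarrow> 'c" where
  "spoke x = \<Delta> {a, x}"

definition rainbow :: "'v set \<Rightarrow> bool" where
  "rainbow S \<longleftrightarrow> inj_on \<Delta> ([S]\<^bsup>2\<^esup>) \<and> insert b (spoke ` S) \<inter> \<Delta> ` [S]\<^bsup>2\<^esup> = {}"

text \<open>Taking \<open>c = b\<close> covers the case that all spokes have colour
  \<open>b\<close>. Two witnesses are demanded so that one survives the deletion of any vertex; a
  subset containing a witness has a count determined by its size.\<close>

definition constant_spokes :: "'c \<Rightarrow> 'v set \<Rightarrow> bool" where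
  "constant_spokes c S \<longleftrightarrow> rainbow S \<and> spoke ` S \<subseteq> {b, c} \<and>
     (\<exists>s\<in>S. \<exists>t\<in>S. s \<noteq> t \<and> spoke s = c \<and> spoke t = c)"

definition distinct_spokes :: "'v set \<Rightarrow> bool" where
  "distinct_spokes S \<longleftrightarrow> rainbow S \<and> inj_on spoke S \<and> b \<notin> spoke ` S"

lemma palette_eq:
  assumes "a \<notin> T"
  shows "palette T = insert b (spoke ` T) \<union> \<Delta> ` [T]\<^bsup>2\<^esup>"
proof
  show "palette T \<subseteq> insert b (spoke ` T) \<union> \<Delta> ` [T]\<^bsup>2\<^esup>"
  proof
    fix c assume "c \<in> palette T"
    then show "c \<in> insert b (spoke ` T) \<union> \<Delta> ` [T]\<^bsup>2\<^esup>"
    proof (cases rule: palette_cases)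
      case (2 x y)
      then consider "x \<in> T" "y \<in> T" | "x = a" "y \<in> T" | "y = a" "x \<in> T" by auto
      then show ?thesis
      proof cases
        case 1 with 2 show ?thesis by auto
      next
        case 2 with \<open>c = \<Delta> {x, y}\<close> show ?thesis by (auto simp: spoke_def)
      next
        case 3 with \<open>c = \<Delta> {x, y}\<close> show ?thesis by (auto simp: spoke_def insert_commute[of _ a])
      qed
    qed simp
  qed
  have "spoke x \<in> palette T" if "x \<in> T" for x
    unfolding spoke_def using that assms by (intro palette_edge) auto
  moreover have "\<Delta> ` [T]\<^bsup>2\<^esup> \<subseteq> palette T"
    unfolding palette_def by (intro subset_insertI2 image_mono nsets_mono) auto
  ultimately show "insert b (spoke ` T) \<union> \<Delta> ` [T]\<^bsup>2\<^esup> \<subseteq> palette T"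
    using base_in_palette by auto
qed

lemma rainbow_subset:
  assumes "rainbow S" "T \<subseteq> S" shows "rainbow T"
proof -
  have "insert b (spoke ` T) \<inter> \<Delta> ` [T]\<^bsup>2\<^esup> \<subseteq> insert b (spoke ` S) \<inter> \<Delta> ` [S]\<^bsup>2\<^esup>"
    using assms(2) by (intro Int_mono insert_mono image_mono nsets_mono)
  moreover have "inj_on \<Delta> ([T]\<^bsup>2\<^esup>)"
    using assms inj_on_subset nsets_mono unfolding rainbow_def by metis
  ultimately show ?thesis using assms(1) unfolding rainbow_def by (metis subset_empty)
qed

lemma cnt_rainbow:
  assumes "rainbow T" "finite T" "a \<notin> T"
  shows "cnt T = (card T choose 2) + card (insert b (spoke ` T))"
proof -
  have "cnt T = card (insert b (spoke ` T)) + card (\<Delta> ` [T]\<^bsup>2\<^esup>)"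
    unfolding cnt_def palette_eq[OF assms(3)]
    using assms by (intro card_Un_disjoint) (auto simp: rainbow_def finite_imp_finite_nsets)
  moreover have "card (\<Delta> ` [T]\<^bsup>2\<^esup>) = card T choose 2"
    using assms(1) by (simp add: card_image rainbow_def)
  ultimately show ?thesis by simp
qed

text \<open>Freeness over a \<open>k\<close>-set separates the colour of \<open>uv\<close> from
  those of the other edges on that set, \<open>u\<close>, \<open>v\<close> and the apex. Since the
  \<open>k\<close>-sets can be chosen at will, \<open>S\<close> is rainbow. Then
  \<open>cnt T\<close> varies only with the number of spoke colours on \<open>T\<close>; freeness
  and the constancy of this number over \<open>k\<close>-sets leave the two listed patterns.\<close>

lemma canonical:
  assumes S: "finite S" "a \<notin> S" and k: "2 \<le> k" "2 * k \<le> card S"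
    and free: "\<And>T u v. T \<subseteq> S \<Longrightarrow> card T = k \<Longrightarrow> u \<in> S - T \<Longrightarrow> v \<in> S - T \<Longrightarrow> u \<noteq> v \<Longrightarrow> free_pair T u v"
    and const: "\<And>T. T \<subseteq> S \<Longrightarrow> card T = k \<Longrightarrow> cnt T = N"
  shows "(\<exists>c. constant_spokes c S) \<or> distinct_spokes S"
proof -
  have new: "\<Delta> {u, v} \<noteq> b \<and> (\<forall>x y. x \<in> insert a S \<longrightarrow> y \<in> insert a S \<longrightarrow> x \<noteq> y \<longrightarrow> {x, y} \<noteq> {u, v} \<longrightarrow> \<Delta> {u, v} \<noteq> \<Delta> {x, y})"
    if uv: "u \<in> S" "v \<in> S" "u \<noteq> v" for u v
  proof -
    \<comment> \<open>\<open>T\<close> collects the endpoints of \<open>xy\<close> in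
      \<open>S\<close> other than \<open>u\<close> and \<open>v\<close>, so that \<open>xy\<close>
      is among the edges that freeness over \<open>T\<close> compares with
      \<open>uv\<close>.\<close>
    have A: "\<exists>T. S \<inter> {x, y} - {u, v} \<subseteq> T \<and> T \<subseteq> S - {u, v} \<and> card T = k" for x y
    proof (rule exists_subset_between)
      have "card (S \<inter> {x, y} - {u, v}) \<le> card {x, y}" by (intro card_mono) auto
      also have "\<dots> \<le> k" using k card_insert_le_m1[of 2 "{y}" x] by (cases "x = y") auto
      finally show "card (S \<inter> {x, y} - {u, v}) \<le> k" .
      show "k \<le> card (S - {u, v})" using S k uv by (simp add: card_Diff_subset)
    qed (use S in auto)
    from A[of u u] obtain T where T: "T \<subseteq> S - {u, v}" "card T = k" by blast
    have "free_pair T u v" using T uv by (intro free) auto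
    then have "\<Delta> {u, v} \<noteq> b" using base_in_palette[of T] by (auto simp: free_pair_def)
    moreover have "\<Delta> {u, v} \<noteq> \<Delta> {x, y}"
      if xy: "x \<in> insert a S" "y \<in> insert a S" "x \<noteq> y" "{x, y} \<noteq> {u, v}" for x y
    proof -
      from A[of x y] obtain T where T: "S \<inter> {x, y} - {u, v} \<subseteq> T" "T \<subseteq> S - {u, v}" "card T = k" by blast
      have "free_pair T u v" using T uv by (intro free) auto
      moreover have "\<Delta> {x, y} \<in> palette T \<union> star u T \<union> star v T"
      proof -
        have "x = u \<or> x = v \<or> x \<in> insert a T" "y = u \<or> y = v \<or> y \<in> insert a T"
          using xy(1,2) T(1) by blast+
        moreover have "\<not> (x = u \<and> y = v)" "\<not> (x = v \<and> y = u)" using xy(4) by blast+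
        ultimately consider "x \<in> insert a T" "y \<in> insert a T" | "x = u" "y \<in> insert a T" | "x = v" "y \<in> insert a T"
          | "y = u" "x \<in> insert a T" | "y = v" "x \<in> insert a T"
          using xy(3) by metis
        then show ?thesis
        proof cases
          case 1 then show ?thesis using palette_edge xy(3) by blast
        qed (auto simp: star_def insert_commute)
      qed
      ultimately show ?thesis by (auto simp: free_pair_def)
    qed
    ultimately show ?thesis by blast
  qed
  have rb: "rainbow S"
    unfolding rainbow_def
  proof
    show "inj_on \<Delta> ([S]\<^bsup>2\<^esup>)"
    proof (rule inj_onI)
      fix e f assume e: "e \<in> [S]\<^bsup>2\<^esup>" and f: "f \<in> [S]\<^bsup>2\<^esup>" and eq: "\<Delta> e = \<Delta> f"
      obtain u v where u: "e = {u, v}" "u \<in> S" "v \<in> S" "u \<noteq> v" using e by (auto elim: nsets2_E)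
      obtain x y where x: "f = {x, y}" "x \<in> S" "y \<in> S" "x \<noteq> y" using f by (auto elim: nsets2_E)
      show "e = f" using new[OF u(2-4)] x eq u(1) by (metis insertI2)
    qed
    show "insert b (spoke ` S) \<inter> \<Delta> ` [S]\<^bsup>2\<^esup> = {}"
    proof -
      have "\<Delta> {u, v} \<notin> insert b (spoke ` S)" if uv: "u \<in> S" "v \<in> S" "u \<noteq> v" for u v
      proof -
        have "\<Delta> {u, v} \<noteq> spoke x" if "x \<in> S" for x
          unfolding spoke_def
          using new[OF uv] that uv S by (metis doubleton_eq_iff insertI1 insertI2)
        then show ?thesis using new[OF uv] by auto
      qed
      then have "\<Delta> e \<notin> insert b (spoke ` S)" if "e \<in> [S]\<^bsup>2\<^esup>" for e
        using nsets2_E[OF that] by metis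
      then show ?thesis unfolding disjoint_iff by (metis imageE)
    qed
  qed
  have sp: "card (insert b (spoke ` T)) = N - (k choose 2)" if "T \<subseteq> S" "card T = k" for T
  proof -
    have "a \<notin> T" using that(1) S(2) by blast
    then have "cnt T = (k choose 2) + card (insert b (spoke ` T))"
      using cnt_rainbow[OF rainbow_subset[OF rb that(1)] finite_subset[OF that(1) S(1)]] that(2) by simp
    then show ?thesis using const[OF that] by simp
  qed
  show ?thesis
  proof (cases "\<exists>u\<in>S. \<exists>v\<in>S. u \<noteq> v \<and> spoke u = spoke v \<and> spoke u \<noteq> b")
    case True
    then obtain u v where uv: "u \<in> S" "v \<in> S" "u \<noteq> v" "spoke u = spoke v" "spoke u \<noteq> b" by blast
    define c where "c = spoke u"
    define C where "C = {x \<in> S. spoke x = c}"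
    \<comment> \<open>Otherwise some \<open>k\<close>-set misses \<open>C\<close> and does not have
      \<open>c\<close> in its palette, although \<open>c\<close> lies in the stars of both
      \<open>u\<close> and \<open>v\<close>; freeness forbids that.\<close>
    have big: "k \<le> card C"
    proof (rule ccontr)
      assume "\<not> ?thesis"
      then have "k \<le> card (S - C)" using k S by (subst card_Diff_subset) (auto simp: C_def)
      then obtain T where T: "T \<subseteq> S - C" "card T = k" by (meson obtain_subset_with_card_n)
      have "free_pair T u v" using T uv by (intro free) (auto simp: C_def c_def)
      moreover have "c \<in> star u T \<inter> star v T"
        using uv by (auto simp: c_def star_def spoke_def insert_commute)
      ultimately have "c \<in> palette T" by (auto simp: free_pair_def)
      moreover have "a \<notin> T" using T S by auto
      ultimately have "c \<in> insert b (spoke ` T) \<union> \<Delta> ` [T]\<^bsup>2\<^esup>" by (simp add: palette_eq)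
      moreover have "c \<notin> \<Delta> ` [T]\<^bsup>2\<^esup>"
        using rb uv(1) T(1) nsets_mono[of T S 2] unfolding rainbow_def c_def by blast
      moreover have "c \<notin> spoke ` T" using T by (auto simp: C_def)
      ultimately show False using uv by (simp add: c_def)
    qed
    have "spoke x \<in> {b, c}" if x: "x \<in> S" for x
    proof (rule ccontr)
      \<comment> \<open>Compare \<open>k\<close> vertices of \<open>C\<close>, which with
        \<open>b\<close> show two colours, and \<open>k - 1\<close> vertices of \<open>C\<close>
        together with \<open>x\<close>, which show three. The bound \<open>2 \<le> k\<close> keeps
        \<open>c\<close> present in the second set.\<close>
      assume d: "spoke x \<notin> {b, c}"
      obtain T where T: "T \<subseteq> C" "card T = k" using big by (meson obtain_subset_with_card_n)
      obtain T' where T': "T' \<subseteq> C" "card T' = k - 1" using big by (meson diff_le_self le_trans obtain_subset_with_card_n)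
      have fin: "finite C" using S by (simp add: C_def)
      have "T \<noteq> {}" "T' \<noteq> {}" using T T' k by auto
      then have im: "spoke ` T = {c}" "spoke ` T' = {c}" using T T' by (auto simp: C_def)
      have "card (insert b (spoke ` T)) = N - (k choose 2)" using T by (intro sp) (auto simp: C_def)
      moreover have "card (insert b (spoke ` insert x T')) = N - (k choose 2)"
      proof (rule sp)
        have "x \<notin> T'" using d T' by (auto simp: C_def)
        then show "card (insert x T') = k" using T' k finite_subset[OF T'(1) fin] by simp
      qed (use T' x in \<open>auto simp: C_def\<close>)
      ultimately show False using d uv(5) by (auto simp: im c_def split: if_splits)
    qed
    then have "constant_spokes c S"
      unfolding constant_spokes_def using rb uv by (auto simp: c_def)
    then show ?thesis by blast
  next
    case False
    then have inj: "\<And>u v. u \<in> S \<Longrightarrow> v \<in> S \<Longrightarrow> spoke u = spoke v \<Longrightarrow> spoke u \<noteq> b \<Longrightarrow> u = v" by blast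
    show ?thesis
    proof (cases "\<exists>z\<in>S. spoke z = b")
      case True
      then obtain z where z: "z \<in> S" "spoke z = b" by blast
      \<comment> \<open>Spoke colours other than \<open>b\<close> are pairwise distinct here, so
        exchanging \<open>z\<close> for \<open>w\<close> in a \<open>k\<close>-set would add a
        colour.\<close>
      have all: "spoke w = b" if w: "w \<in> S" for w
      proof (rule ccontr)
        assume nb: "spoke w \<noteq> b"
        have "z \<noteq> w" using z nb by auto
        then have "card (S - {z, w}) \<ge> k - 1" using S k z w by (simp add: card_Diff_subset)
        then obtain T where T: "T \<subseteq> S - {z, w}" "card T = k - 1" by (meson obtain_subset_with_card_n)
        have fT: "finite T" using T S by (meson Diff_subset finite_subset)
        have "z \<notin> T" "w \<notin> T" "T \<subseteq> S" using T by auto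
        then have "insert z T \<subseteq> S" "card (insert z T) = k" "insert w T \<subseteq> S" "card (insert w T) = k"
          using T(2) fT z(1) w k by auto
        then have "card (insert b (spoke ` insert z T)) = card (insert b (spoke ` insert w T))"
          using sp by metis
        moreover have "spoke w \<notin> insert b (spoke ` T)"
        proof
          assume "spoke w \<in> insert b (spoke ` T)"
          then obtain t where "t \<in> T" "spoke w = spoke t" using nb by blast
          then show False using inj[OF w _ _ nb] \<open>w \<notin> T\<close> \<open>T \<subseteq> S\<close> by blast
        qed
        then have "card (insert b (spoke ` insert w T)) = Suc (card (insert b (spoke ` T)))"
          using fT by (simp add: insert_commute[of b])
        ultimately show False using z(2) by simp
      qed
      obtain t where "t \<in> S" "t \<noteq> z"
      proof -
        have "\<not> card S \<le> Suc 0" using k by linarith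
        then show ?thesis using that z(1) S(1) card_le_Suc0_iff_eq[of S] by metis
      qed
      then have "constant_spokes b S" unfolding constant_spokes_def using rb all z by auto
      then show ?thesis by blast
    next
      case False
      then have "distinct_spokes S" using rb inj by (auto simp: distinct_spokes_def intro!: inj_onI)
      then show ?thesis by blast
    qed
  qed
qed

end

section \<open>From a single free pair to a canonical set\<close>

context nearly_rainbow
begin

text \<open>Fix \<open>u\<close> in a set \<open>Y\<close> of size \<open>k + 2\<close> and look for
  a partner \<open>v\<close>, with \<open>T\<close> the rest of \<open>Y\<close>. All but at most
  \<open>e\<close> edges at \<open>u\<close> carry distinct colours lost at \<open>u\<close>, and
  only the colours \<open>\<Gamma>\<close> of the remaining edges can spoil freeness. They exclude
  at most \<open>3 * e\<close> vertices and the apex is one more, fewer than the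
  \<open>k + 2 - e\<close> or more candidates in \<open>I'\<close>.\<close>

lemma ex_free_pair:
  assumes k: "4 * e \<le> k" "k + 2 \<le> card S"
  obtains T u v where "T \<subseteq> S" "card T = k" "u \<in> S - T" "v \<in> S - T" "u \<noteq> v" "free_pair T u v"
proof -
  obtain Y where Y: "Y \<subseteq> S" "card Y = k + 2" using k(2) by (meson obtain_subset_with_card_n)
  have fY: "finite Y" and aY: "a \<notin> Y" using Y finite_T apex_S by blast+
  obtain u where u: "u \<in> Y" using Y(2) by fastforce
  let ?f = "\<lambda>x. \<Delta> {u, x}"
  define I where "I = insert a (Y - {u})"
  have cI: "card I = k + 2" "finite I" using Y fY u aY by (auto simp: I_def)
  have "loss Y u \<subseteq> ?f ` I" using loss_subset_star[OF u aY] by (simp add: star_def I_def)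
  then obtain I' where I': "I' \<subseteq> I" "inj_on ?f I'" "loss Y u = ?f ` I'" by (auto simp: subset_image_inj)
  have fI': "finite I'" using I' cI finite_subset by blast
  have cI': "k + 2 \<le> card I' + e"
    using loss_large_sub[OF Y(1) u] Y(2) I' card_image[OF I'(2)] by simp
  define \<Gamma> where "\<Gamma> = ?f ` (I - I')"
  have "card \<Gamma> \<le> card (I - I')" unfolding \<Gamma>_def using cI by (intro card_image_le) auto
  also have "\<dots> = card I - card I'" using I' fI' by (intro card_Diff_subset)
  finally have c\<Gamma>: "card \<Gamma> \<le> e" "finite \<Gamma>" using cI cI' by (auto simp: \<Gamma>_def)
  define B1 where "B1 = {x \<in> I'. ?f x \<in> \<Gamma>}"
  have "card B1 = card (?f ` B1)" using I'(2) by (intro card_image[symmetric] inj_on_subset[OF I'(2)]) (auto simp: B1_def)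
  also have "\<dots> \<le> card \<Gamma>" using c\<Gamma> by (intro card_mono) (auto simp: B1_def)
  finally have cB1: "card B1 \<le> e" using c\<Gamma> by simp
  \<comment> \<open>\<open>B2 \<gamma>\<close> collects the partners whose star would share with the
    star of \<open>u\<close> a colour \<open>\<gamma>\<close> missing from the palette of the rest.
    There are at most two: if \<open>\<gamma>\<close> sits on \<open>vw\<close>, deleting a vertex
    other than \<open>v\<close> and \<open>w\<close> keeps this edge.\<close>
  define B2 where "B2 = (\<lambda>\<gamma>. {v \<in> Y - {u}. \<gamma> \<notin> palette (Y - {u, v}) \<and> \<gamma> \<in> star v (Y - {u, v})})"
  have cB2: "card (B2 \<gamma>) \<le> 2" for \<gamma>
  proof (cases "B2 \<gamma> = {}")
    case False
    then obtain v where v: "v \<in> B2 \<gamma>" by blast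
    then obtain w where w: "w \<in> insert a (Y - {u, v})" "\<gamma> = \<Delta> {v, w}" by (auto simp: B2_def star_def)
    have "B2 \<gamma> \<subseteq> {v, w}"
    proof
      fix v' assume v': "v' \<in> B2 \<gamma>"
      show "v' \<in> {v, w}"
      proof (rule ccontr)
        assume "v' \<notin> {v, w}"
        then have "\<gamma> \<in> palette (Y - {u, v'})"
          unfolding w(2) using v w aY by (intro palette_edge) (auto simp: B2_def)
        then show False using v' by (simp add: B2_def)
      qed
    qed
    then have "card (B2 \<gamma>) \<le> card {v, w}" by (intro card_mono) auto
    also have "\<dots> \<le> 2" by (cases "v = w") auto
    finally show ?thesis .
  qed simp
  have "card (\<Union>\<gamma>\<in>\<Gamma>. B2 \<gamma>) \<le> (\<Sum>\<gamma>\<in>\<Gamma>. card (B2 \<gamma>))" using c\<Gamma> by (intro card_UN_le) auto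
  also have "\<dots> \<le> (\<Sum>\<gamma>\<in>\<Gamma>. 2)" by (intro sum_mono cB2)
  also have "\<dots> \<le> 2 * e" using c\<Gamma> by simp
  finally have cB: "card (\<Union>\<gamma>\<in>\<Gamma>. B2 \<gamma>) \<le> 2 * e" .
  let ?B = "insert a (B1 \<union> (\<Union>\<gamma>\<in>\<Gamma>. B2 \<gamma>))"
  have finB: "finite ?B" using c\<Gamma> fI' fY by (auto simp: B1_def B2_def)
  have "card ?B \<le> Suc (card (B1 \<union> (\<Union>\<gamma>\<in>\<Gamma>. B2 \<gamma>)))" using card_insert_le_m1 finB by (simp add: card_insert_if)
  also have "\<dots> \<le> Suc (e + 2 * e)" using card_Un_le[of B1 "\<Union>\<gamma>\<in>\<Gamma>. B2 \<gamma>"] cB cB1 by linarith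
  also have "\<dots> < card I'" using cI' k by linarith
  finally have "\<not> I' \<subseteq> ?B" using card_mono[OF finB] by (meson leD)
  then obtain v where v: "v \<in> I'" "v \<noteq> a" "v \<notin> B1" "\<And>\<gamma>. \<gamma> \<in> \<Gamma> \<Longrightarrow> v \<notin> B2 \<gamma>" by blast
  have vY: "v \<in> Y" "v \<noteq> u" using v I' by (auto simp: I_def)
  let ?T = "Y - {u, v}"
  have IT: "I = insert v (insert a ?T)" using vY by (auto simp: I_def)
  have "insert v ?T = Y - {u}" using vY by auto
  then have pal: "palette (Y - {u}) = palette ?T \<union> star v ?T"
    using palette_insert[of v ?T] v by auto
  have lossn: "\<Delta> {u, x} \<notin> palette ?T \<union> star v ?T" if "x \<in> I'" for x
  proof -
    have "\<Delta> {u, x} \<in> loss Y u" using that I'(3) by blast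
    then show ?thesis by (simp add: loss_def pal)
  qed
  have "\<Delta> {u, v} \<notin> star u ?T"
  proof
    assume "\<Delta> {u, v} \<in> star u ?T"
    then obtain x where x: "x \<in> insert a ?T" "\<Delta> {u, v} = \<Delta> {u, x}" by (auto simp: star_def)
    have xv: "x \<noteq> v" "x \<in> I" using x v IT by auto
    show False
    proof (cases "x \<in> I'")
      case True then show False using xv x(2) I'(2) v(1) by (auto dest: inj_onD)
    next
      case False
      then have "\<Delta> {u, v} \<in> \<Gamma>" using xv x(2) by (auto simp: \<Gamma>_def)
      then show False using v by (simp add: B1_def)
    qed
  qed
  moreover have "\<gamma> \<in> palette ?T" if \<gamma>: "\<gamma> \<in> star u ?T" "\<gamma> \<in> star v ?T" for \<gamma>
  proof (rule ccontr)
    assume n: "\<gamma> \<notin> palette ?T"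
    obtain x where x: "x \<in> insert a ?T" "\<gamma> = \<Delta> {u, x}" using \<gamma>(1) by (auto simp: star_def)
    then have "x \<notin> I'" using \<gamma>(2) lossn by auto
    then have "\<gamma> \<in> \<Gamma>" using x IT by (auto simp: \<Gamma>_def)
    then have "v \<notin> B2 \<gamma>" by (rule v(4))
    then show False using n \<gamma>(2) vY by (simp add: B2_def)
  qed
  ultimately have "free_pair ?T u v" using lossn[OF v(1)] by (auto simp: free_pair_def)
  moreover have "card ?T = k" using Y(2) fY u vY by (simp add: card_Diff_subset)
  ultimately show ?thesis using that[of ?T u v] Y u vY by auto
qed

text \<open>On sizes \<open>k + 1\<close> to \<open>k + 3\<close> the count depends on the size
  alone, hence so does the second difference at a \<open>(k + 1)\<close>-set. One free pair over
  such a set therefore makes all pairs over all such sets free.\<close>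

lemma canonical_if_window:
  assumes k: "4 * e < k" "2 \<le> k" "2 * k + 4 \<le> card S"
    and few: "card (vals \<inter> {maxcnt k<..maxcnt (k + 3)}) \<le> 3"
  shows "(\<exists>c. constant_spokes c S) \<or> distinct_spokes S"
proof -
  have const: "cnt T = maxcnt (card T)" if "T \<subseteq> S" "k < card T" "card T \<le> k + 3" for T
    using that k few by (intro window_constant[of k]) auto
  have sums: "cnt (insert u (insert v T)) = maxcnt (k + 3) \<and> cnt T = maxcnt (k + 1) \<and>
      cnt (insert u T) = maxcnt (k + 2) \<and> cnt (insert v T) = maxcnt (k + 2)"
    if T: "T \<subseteq> S" "card T = k + 1" and uv: "u \<in> S - T" "v \<in> S - T" "u \<noteq> v" for T u v
  proof -
    have fT: "finite T" using T finite_T by blast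
    show ?thesis
      using const[of T] const[of "insert u T"] const[of "insert v T"] const[of "insert u (insert v T)"] T uv fT
      by (simp add: numeral_3_eq_3 numeral_2_eq_2)
  qed
  have iff: "free_pair T u v \<longleftrightarrow> maxcnt (k + 3) + maxcnt (k + 1) = maxcnt (k + 2) + maxcnt (k + 2) + 1"
    if T: "T \<subseteq> S" "card T = k + 1" and uv: "u \<in> S - T" "v \<in> S - T" "u \<noteq> v" for T u v
    using sums[OF that] free_pair_iff[of T u v] uv apex_S finite_T[OF T(1)] by auto
  obtain T u v where "T \<subseteq> S" "card T = k + 1" "u \<in> S - T" "v \<in> S - T" "u \<noteq> v" "free_pair T u v"
    by (rule ex_free_pair[of "k + 1"]) (use k in auto)
  then have eq: "maxcnt (k + 3) + maxcnt (k + 1) = maxcnt (k + 2) + maxcnt (k + 2) + 1" using iff by blast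
  show ?thesis
  proof (rule canonical[OF finite_S apex_S, of "k + 1" "maxcnt (k + 1)"])
    show "free_pair T u v" if "T \<subseteq> S" "card T = k + 1" "u \<in> S - T" "v \<in> S - T" "u \<noteq> v" for T u v
      using iff[OF that] eq by simp
    show "cnt T = maxcnt (k + 1)" if "T \<subseteq> S" "card T = k + 1" for T using const[of T] that by simp
  qed (use k in auto)
qed

end

context few_values
begin

lemma ex_canonical:
  obtains S where "S \<subseteq> V" "998 * y \<le> card S" "(\<exists>c. constant_spokes c S) \<or> distinct_spokes S"
proof -
  obtain S where S: "S \<subseteq> V" "n + 1 \<le> card S + 2 * y" "\<And>x. x \<in> S \<Longrightarrow> card S \<le> card (loss S x) + 6 * y"
    by (rule ex_nearly_rainbow) blast
  have nr: "nearly_rainbow \<Delta> b a V S (6 * y)" by unfold_locales (use S in auto)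
  define g where "g = nearly_rainbow.maxcnt \<Delta> b a S"
  have p: "998 * y \<le> card S" using S(2) n_lower by linarith
  have "\<exists>k\<ge>400 * y. k + 3 \<le> 415 * y \<and> card (vals \<inter> {g k<..g (k + 3)}) \<le> 3"
  proof (rule window)
    fix k assume k: "400 * y \<le> k" "k < 415 * y"
    then have "k < card S" using p by linarith
    from nearly_rainbow.maxcnt_Suc[OF nr this, folded g_def] k y_large show "g k < g (Suc k)" "g (Suc k) \<le> g k + Suc k"
      by linarith+
  next
    \<comment> \<open>Twice the count is at least about
      \<open>(400 ^ 2 - 2 * 6 * 400) * y ^ 2\<close>, that is \<open>155200 * y ^ 2\<close>, which
      exceeds \<open>388 ^ 2 * y ^ 2\<close>.\<close>
    have "(Suc (400 * y) choose 2) + 1 \<le> g (400 * y) + 6 * y * (400 * y)"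
      unfolding g_def
      using p by (intro nearly_rainbow.maxcnt_lower[OF nr]) linarith
    moreover have "2 * (Suc (400 * y) choose 2) = Suc (400 * y) * (400 * y)" by (simp only: double_choose_two) simp
    moreover have "2 * (388 * y choose 2) \<le> 388 * y * (388 * y)"
      unfolding double_choose_two by (intro mult_le_mono2) simp
    ultimately show "(388 * y choose 2) + 1 \<le> g (400 * y)" by simp
  qed
  then obtain k where "400 * y \<le> k" "k + 3 \<le> 415 * y" "card (vals \<inter> {g k<..g (k + 3)}) \<le> 3" by blast
  then have "(\<exists>c. constant_spokes c S) \<or> distinct_spokes S"
    using p y_large by (intro nearly_rainbow.canonical_if_window[OF nr, of k]) (auto simp: g_def)
  with S(1) p that show ?thesis by blast
qed

end

subsection \<open>Extending canonical sets\<close>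

lemma inj_on_if_card_image_Diff:
  assumes "finite S" "card S \<le> card (f ` S - P)"
  shows "inj_on f S \<and> f ` S \<inter> P = {}"
proof -
  have "card (f ` S - P) \<le> card (f ` S)" using assms by (intro card_mono) auto
  moreover have "card (f ` S) \<le> card S" using assms by (intro card_image_le)
  ultimately have eq: "card (f ` S) = card S" "card (f ` S - P) = card (f ` S)" using assms(2) by linarith+
  have "f ` S - P = f ` S" using assms eq by (intro card_subset_eq) auto
  then show ?thesis using eq assms eq_card_imp_inj_on by blast
qed

lemma almost_inj_on_if_card_image_Diff:
  assumes "finite S" "S \<noteq> {}" "card S \<le> Suc (card (f ` S - P))"
  obtains w where "w \<in> S" "inj_on f (S - {w})" "f ` (S - {w}) \<inter> P = {}"
proof -
  have "f ` S - P \<subseteq> f ` S" by auto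
  then obtain R where R: "R \<subseteq> S" "inj_on f R" "f ` S - P = f ` R" by (auto simp: subset_image_inj)
  have fR: "finite R" using R assms finite_subset by blast
  have "card S \<le> Suc (card R)" using assms(3) R card_image[OF R(2)] by simp
  then have "card (S - R) \<le> 1" using R fR by (simp add: card_Diff_subset)
  have "\<exists>w\<in>S. S - R \<subseteq> {w}"
  proof (cases "S - R = {}")
    case False
    with \<open>card (S - R) \<le> 1\<close> have "card (S - R) = 1" using assms(1) by (simp add: card_eq_0_iff le_antisym Suc_leI card_gt_0_iff)
    then obtain w where "S - R = {w}" by (rule card_1_singletonE)
    then show ?thesis by blast
  qed (use assms(2) in blast)
  then obtain w where w: "w \<in> S" "S - R \<subseteq> {w}" by blast
  then have "S - {w} \<subseteq> R" by auto
  then have "inj_on f (S - {w})" "f ` (S - {w}) \<inter> P = {}" using R inj_on_subset by blast+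
  with w that show ?thesis by blast
qed

context pointed_colouring
begin

definition fresh :: "'v \<Rightarrow> 'v set \<Rightarrow> 'c set" where
  "fresh v T = star v T - palette T"

lemma finite_fresh [simp]: "finite T \<Longrightarrow> finite (fresh v T)"
  by (simp add: fresh_def)

lemma cnt_insert_fresh:
  assumes "finite T" "v \<notin> insert a T" shows "cnt (insert v T) = cnt T + card (fresh v T)"
proof -
  have "palette T \<union> star v T = palette T \<union> fresh v T" by (auto simp: fresh_def)
  moreover have "palette T \<inter> fresh v T = {}" by (auto simp: fresh_def)
  ultimately show ?thesis
    unfolding cnt_def palette_insert[OF assms(2)] using assms(1) by (simp add: card_Un_disjoint)
qed

text \<open>A shortfall of \<open>j\<close> fresh colours at \<open>v\<close> is witnessed by \<open>j\<close> redundant edges at \<open>v\<close>; the colour of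
  each reappears on one further edge, which has at most two endpoints.\<close>

lemma shortfall_witness:
  assumes S: "finite S" "a \<notin> S" and j: "card (fresh v S) + j \<le> Suc (card S)"
  obtains W where "W \<subseteq> S" "card W \<le> 3 * j"
    "\<And>T. W \<subseteq> T \<Longrightarrow> T \<subseteq> S \<Longrightarrow> card (fresh v T) + j \<le> Suc (card T)"
proof -
  let ?f = "\<lambda>x. \<Delta> {v, x}"
  have "fresh v S \<subseteq> ?f ` insert a S" by (auto simp: fresh_def star_def)
  then obtain I' where I': "I' \<subseteq> insert a S" "inj_on ?f I'" "fresh v S = ?f ` I'" unfolding subset_image_inj by blast
  have fI': "finite I'" using I' S by (meson finite_insert finite_subset)
  have "card (insert a S - I') = Suc (card S) - card (fresh v S)"
    using S I' fI' card_image[OF I'(2)] by (simp add: card_Diff_subset)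
  then have "j \<le> card (insert a S - I')" using j by linarith
  \<comment> \<open>\<open>I'\<close> has one endpoint per fresh colour, so the edges from
    \<open>v\<close> to \<open>J\<close> are redundant. The apex may belong to \<open>J\<close>,
    hence \<open>J - {a}\<close> in \<open>W\<close> below.\<close>
  then obtain J where J: "J \<subseteq> insert a S - I'" "card J = j" by (meson obtain_subset_with_card_n)
  have fJ: "finite J" using J S by (meson finite_Diff finite_insert finite_subset)
  \<comment> \<open>\<open>E\<close> holds the endpoints in \<open>S\<close> of an edge that repeats
    the colour of \<open>vx\<close>, either on \<open>insert a S\<close> or from \<open>v\<close> to
    a representative in \<open>I'\<close>; it is empty if the colour is \<open>b\<close>. Once
    \<open>E\<close> lies in \<open>T\<close>, the edge \<open>vx\<close> contributes
    nothing.\<close>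
  have "\<exists>E. E \<subseteq> S \<and> card E \<le> 2 \<and> (?f x \<in> palette E \<or> ?f x \<in> ?f ` (I' \<inter> insert a E))" if x: "x \<in> J" for x
  proof (cases "?f x \<in> palette S")
    case True
    then show ?thesis
    proof (cases rule: palette_cases)
      case 1 then show ?thesis using base_in_palette[of "{}"] by (intro exI[of _ "{}"]) auto
    next
      case (2 y z)
      have "card ({y, z} - {a}) \<le> card {y, z}" by (intro card_mono) auto
      also have "\<dots> \<le> 2" by (cases "y = z") auto
      finally have "card ({y, z} - {a}) \<le> 2" .
      moreover have "?f x \<in> palette ({y, z} - {a})" unfolding 2(4) using 2(3) by (intro palette_edge) auto
      moreover have "{y, z} - {a} \<subseteq> S" using 2 by auto
      ultimately show ?thesis by blast
    qed
  next
    case False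
    then have "?f x \<in> fresh v S" using x J(1) by (auto simp: fresh_def star_def)
    then obtain i where i: "i \<in> I'" "?f x = ?f i" using I'(3) by auto
    have "card ({i} - {a}) \<le> card {i}" by (intro card_mono) auto
    moreover have "?f x \<in> ?f ` (I' \<inter> insert a ({i} - {a}))" using i by auto
    moreover have "{i} - {a} \<subseteq> S" using i I'(1) by auto
    ultimately show ?thesis by (intro exI[of _ "{i} - {a}"]) auto
  qed
  then obtain E where E: "\<And>x. x \<in> J \<Longrightarrow> E x \<subseteq> S" "\<And>x. x \<in> J \<Longrightarrow> card (E x) \<le> 2"
    "\<And>x. x \<in> J \<Longrightarrow> ?f x \<in> palette (E x) \<or> ?f x \<in> ?f ` (I' \<inter> insert a (E x))" by metis
  define W where "W = (J - {a}) \<union> (\<Union>x\<in>J. E x)"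
  show ?thesis
  proof (rule that)
    show "W \<subseteq> S" using J E(1) by (auto simp: W_def)
    have "card W \<le> card (J - {a}) + card (\<Union>x\<in>J. E x)" unfolding W_def by (rule card_Un_le)
    also have "card (J - {a}) \<le> card J" using fJ by (intro card_mono) auto
    also have "card (\<Union>x\<in>J. E x) \<le> (\<Sum>x\<in>J. card (E x))" using fJ by (rule card_UN_le)
    also have "\<dots> \<le> (\<Sum>x\<in>J. 2)" by (intro sum_mono E(2))
    finally show "card W \<le> 3 * j" using J by simp
  next
    fix T assume T: "W \<subseteq> T" "T \<subseteq> S"
    have fT: "finite T" and aT: "a \<notin> T" using T S finite_subset by blast+
    have "fresh v T \<subseteq> ?f ` (insert a T - J)"
    proof
      fix c assume c: "c \<in> fresh v T"
      then obtain x where x: "x \<in> insert a T" "c = ?f x" by (auto simp: fresh_def star_def)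
      show "c \<in> ?f ` (insert a T - J)"
      proof (cases "x \<in> J")
        case True
        have ET: "E x \<subseteq> T" using T True by (auto simp: W_def)
        have "?f x \<notin> palette (E x)" using c x(2) palette_mono[OF ET] by (auto simp: fresh_def)
        then obtain i where "i \<in> I' \<inter> insert a (E x)" "?f x = ?f i" using E(3)[OF True] by auto
        moreover from this have "i \<in> insert a T - J" using ET J(1) by auto
        ultimately show ?thesis using x(2) by auto
      qed (use x in auto)
    qed
    then have "card (fresh v T) \<le> card (?f ` (insert a T - J))" using fT by (intro card_mono) auto
    also have "\<dots> \<le> card (insert a T - J)" using fT by (intro card_image_le) auto
    also have "\<dots> = Suc (card T) - j"
    proof -
      have "J \<subseteq> insert a T" using T by (auto simp: W_def)
      then show ?thesis using fJ fT aT J by (simp add: card_Diff_subset)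
    qed
    finally have "card (fresh v T) \<le> Suc (card T) - j" .
    moreover have "J \<subseteq> insert a T" using T by (auto simp: W_def)
    then have "j \<le> Suc (card T)" using card_mono[of "insert a T" J] fT aT J(2) by simp
    ultimately show "card (fresh v T) + j \<le> Suc (card T)" by linarith
  qed
qed

lemma rainbow_insert:
  assumes S: "rainbow S" "v \<notin> insert a S" "a \<notin> S"
    and f: "inj_on (\<lambda>x. \<Delta> {v, x}) S" "(\<lambda>x. \<Delta> {v, x}) ` S \<inter> palette S = {}"
    and sv: "spoke v \<notin> (\<lambda>x. \<Delta> {v, x}) ` S" "spoke v \<notin> \<Delta> ` [S]\<^bsup>2\<^esup>"
  shows "rainbow (insert v S)"
proof -
  have eq: "[insert v S]\<^bsup>2\<^esup> = [S]\<^bsup>2\<^esup> \<union> (\<lambda>x. {v, x}) ` S"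
    using S(2) by (auto simp: nsets_2_eq)
  have im: "\<Delta> ` (\<lambda>x. {v, x}) ` S = (\<lambda>x. \<Delta> {v, x}) ` S" by (simp add: image_image)
  have pal: "palette S = insert b (spoke ` S) \<union> \<Delta> ` [S]\<^bsup>2\<^esup>" by (rule palette_eq[OF S(3)])
  have "inj_on \<Delta> ([insert v S]\<^bsup>2\<^esup>)"
    unfolding eq inj_on_Un
  proof (intro conjI)
    show "inj_on \<Delta> ([S]\<^bsup>2\<^esup>)" using S by (simp add: rainbow_def)
    show "inj_on \<Delta> ((\<lambda>x. {v, x}) ` S)" using f(1) by (auto simp: inj_on_def)
    have "\<Delta> ` [S]\<^bsup>2\<^esup> \<inter> \<Delta> ` (\<lambda>x. {v, x}) ` S = {}" unfolding im using f(2) pal by blast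
    then show "\<Delta> ` ([S]\<^bsup>2\<^esup> - (\<lambda>x. {v, x}) ` S) \<inter> \<Delta> ` ((\<lambda>x. {v, x}) ` S - [S]\<^bsup>2\<^esup>) = {}" by blast
  qed
  moreover have "insert b (spoke ` insert v S) \<inter> \<Delta> ` [insert v S]\<^bsup>2\<^esup> = {}"
  proof -
    have "insert b (spoke ` S) \<inter> \<Delta> ` [S]\<^bsup>2\<^esup> = {}" using S(1) by (simp only: rainbow_def)
    moreover have "(\<lambda>x. \<Delta> {v, x}) ` S \<inter> insert b (spoke ` S) = {}" using f(2) unfolding pal by (simp only: Int_Un_distrib Un_empty)
    moreover have "insert b (spoke ` insert v S) = insert (spoke v) (insert b (spoke ` S))" by auto
    moreover have "insert x P \<inter> (E \<union> R) = {}"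
      if "P \<inter> E = {}" "R \<inter> P = {}" "x \<notin> R" "x \<notin> E" for x :: 'c and P E R using that by blast
    ultimately show ?thesis unfolding eq image_Un im using sv by metis
  qed
  ultimately show ?thesis by (simp add: rainbow_def)
qed

text \<open>A colour outside \<open>palette S\<close> sits on an edge with an endpoint outside
  \<open>insert a S\<close>. If no single vertex brings a new colour, neither endpoint can lie in
  \<open>insert a S\<close>.\<close>

lemma new_vertex_or_pair:
  assumes "S \<subseteq> V" "cnt S \<noteq> cnt V"
  obtains v where "v \<in> V - S" "\<not> star v S \<subseteq> palette S"
  | v w where "v \<in> V - S" "w \<in> V - S" "v \<noteq> w" "star v S \<subseteq> palette S" "star w S \<subseteq> palette S"
      "\<Delta> {v, w} \<notin> palette S"
proof (cases "\<exists>v\<in>V - S. \<not> star v S \<subseteq> palette S")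
  case False
  then have old: "\<And>v. v \<in> V - S \<Longrightarrow> star v S \<subseteq> palette S" by blast
  have "palette S \<noteq> palette V" using assms by (auto simp: cnt_def)
  then obtain c where c: "c \<in> palette V" "c \<notin> palette S" using palette_mono[OF assms(1)] by blast
  from c(1) show ?thesis
  proof (cases rule: palette_cases)
    case 1 then show ?thesis using c base_in_palette by blast
  next
    case (2 x y)
    have ns: "x \<notin> insert a S \<or> y \<notin> insert a S" using c(2) palette_edge[of x S y] 2 by auto
    have "x \<notin> insert a S"
    proof
      assume "x \<in> insert a S"
      moreover from this ns have "y \<in> V - S" using 2 by auto
      moreover have "c = \<Delta> {y, x}" using 2(4) by (simp add: insert_commute)
      ultimately show False using old[of y] c(2) by (auto simp: star_def)
    qed
    moreover have "y \<notin> insert a S"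
    proof
      assume "y \<in> insert a S"
      moreover from this ns have "x \<in> V - S" using 2 by auto
      ultimately show False using old[of x] c(2) 2(4) by (auto simp: star_def)
    qed
    ultimately have "x \<in> V - S" "y \<in> V - S" using 2 by auto
    then show ?thesis using that(2) 2 old c by blast
  qed
qed (use that in blast)

text \<open>Over a \<open>k\<close>-set \<open>T\<close> containing \<open>s\<close> and the
  shortfall witnesses of both vertices, \<open>v\<close> alone gains at most \<open>k - 1\<close>
  colours, so by \<open>gap\<close> it gains none; likewise \<open>w\<close>. Together they gain
  exactly the colour of \<open>vw\<close>, a value inside the gap. At most 6 witnesses each and
  \<open>s\<close> account for the 13.\<close>

lemma no_new_pair:
  assumes S: "S \<subseteq> V" and v: "v \<in> V - S" "w \<in> V - S" "v \<noteq> w"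
    and old: "star v S \<subseteq> palette S" "star w S \<subseteq> palette S" and new: "\<Delta> {v, w} \<notin> palette S"
    and s: "s \<in> S" and k: "13 \<le> k" "k \<le> card S"
    and gap: "\<And>T q. T \<subseteq> S \<Longrightarrow> card T = k \<Longrightarrow> s \<in> T \<Longrightarrow> q \<in> vals \<Longrightarrow> cnt T < q \<Longrightarrow> cnt T + k \<le> q"
  shows False
proof -
  have fS: "finite S" and aS: "a \<notin> S" using S finite_sub sub_apex by blast+
  have "fresh v S = {}" "fresh w S = {}" using old by (auto simp: fresh_def)
  then have c: "card (fresh v S) + 2 \<le> Suc (card S)" "card (fresh w S) + 2 \<le> Suc (card S)" using k by auto
  obtain W where W: "W \<subseteq> S" "card W \<le> 3 * 2"
    "\<And>T. W \<subseteq> T \<Longrightarrow> T \<subseteq> S \<Longrightarrow> card (fresh v T) + 2 \<le> Suc (card T)"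
    using shortfall_witness[OF fS aS c(1)] by blast
  obtain W' where W': "W' \<subseteq> S" "card W' \<le> 3 * 2"
    "\<And>T. W' \<subseteq> T \<Longrightarrow> T \<subseteq> S \<Longrightarrow> card (fresh w T) + 2 \<le> Suc (card T)"
    using shortfall_witness[OF fS aS c(2)] by blast
  have "\<exists>T. insert s (W \<union> W') \<subseteq> T \<and> T \<subseteq> S \<and> card T = k"
  proof (rule exists_subset_between)
    have "card (insert s (W \<union> W')) \<le> Suc (card (W \<union> W'))" by (rule card_insert_le_m1[of "Suc _", simplified]) simp
    then show "card (insert s (W \<union> W')) \<le> k" using card_Un_le[of W W'] W(2) W'(2) k by linarith
  qed (use W W' s k fS in auto)
  then obtain T where T: "s \<in> T" "W \<subseteq> T" "W' \<subseteq> T" "T \<subseteq> S" "card T = k" by auto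
  have fT: "finite T" using T fS finite_subset by blast
  have nv: "v \<notin> insert a T" "w \<notin> insert a T" using v T apex by auto
  have TV: "insert v T \<in> Pow V" "insert w T \<in> Pow V" "insert v (insert w T) \<in> Pow V" using v T S by auto
  have none: "fresh u T = {}" if u: "u \<notin> insert a T" "insert u T \<in> Pow V" "card (fresh u T) + 2 \<le> Suc (card T)" for u
  proof (rule ccontr)
    assume "fresh u T \<noteq> {}"
    then have "card (fresh u T) > 0" using fT by (simp add: card_gt_0_iff)
    moreover have "cnt (insert u T) \<in> vals" using u(2) unfolding vals_def by (rule imageI)
    ultimately have "cnt T + k \<le> cnt (insert u T)"
      using cnt_insert_fresh[OF fT u(1)] T by (intro gap) auto
    then show False using u(3) cnt_insert_fresh[OF fT u(1)] T by simp
  qed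
  have "fresh v T = {}" by (rule none[OF nv(1) TV(1) W(3)[OF T(2,4)]])
  moreover have "fresh w T = {}" by (rule none[OF nv(2) TV(2) W'(3)[OF T(3,4)]])
  ultimately have "palette T \<union> star w T = palette T" "palette T \<union> star v T = palette T"
    unfolding fresh_def by blast+
  then have "palette (insert v (insert w T)) = insert (\<Delta> {v, w}) (palette T)"
    using palette_insert[of w T] palette_insert[of v "insert w T"] nv v(3) by (simp add: star_insert)
  moreover have "\<Delta> {v, w} \<notin> palette T" using new palette_mono[OF T(4)] by blast
  ultimately have "cnt (insert v (insert w T)) = Suc (cnt T)" using fT by (simp add: cnt_def)
  moreover have "cnt (insert v (insert w T)) \<in> vals" using TV(3) unfolding vals_def by (rule imageI)
  ultimately show False using gap[OF T(4,5,1), of "Suc (cnt T)"] k by simp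
qed

text \<open>\<open>M\<close> has the largest size among the subsets of \<open>V\<close> with
  \<open>P\<close>, so it cannot be enlarged by a vertex; it need not contain
  \<open>S\<close>.\<close>

lemma ex_max_superset:
  assumes "P S" "S \<subseteq> V"
  obtains M where "P M" "M \<subseteq> V" "card S \<le> card M" "\<And>v. v \<in> V - M \<Longrightarrow> \<not> P (insert v M)"
proof -
  let ?Q = "\<lambda>M. P M \<and> M \<subseteq> V"
  have "\<And>M. ?Q M \<Longrightarrow> card M < Suc (card V)" using finite_V by (auto simp: less_Suc_eq_le intro: card_mono)
  then obtain M where M: "?Q M" "\<And>M'. ?Q M' \<Longrightarrow> card M' \<le> card M"
    using ex_has_greatest_nat[of ?Q S card "Suc (card V)"] assms by (metis less_imp_le)
  have "\<not> P (insert v M)" if v: "v \<in> V - M" for v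
  proof
    assume "P (insert v M)"
    then have "card (insert v M) \<le> card M" using M v by auto
    then show False using v M finite_sub[of M] by simp
  qed
  with M assms that[of M] show ?thesis by blast
qed

lemma cnt_constant_spokes:
  assumes "constant_spokes c S" "finite S" "a \<notin> S" "T \<subseteq> S" "s \<in> T" "spoke s = c"
  shows "cnt T = (card T choose 2) + card {b, c}"
proof -
  have "insert b (spoke ` T) = {b, c}" using assms by (auto simp: constant_spokes_def)
  moreover have "rainbow T" "finite T" "a \<notin> T"
    using assms(1,3,4) finite_subset[OF assms(4,2)] rainbow_subset[OF _ assms(4)]
    unfolding constant_spokes_def by blast+
  ultimately show ?thesis using cnt_rainbow[of T] by simp
qed

lemma cnt_distinct_spokes:
  assumes "distinct_spokes S" "finite S" "a \<notin> S" "T \<subseteq> S"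
  shows "cnt T = (Suc (card T) choose 2) + 1"
proof -
  have T: "rainbow T" "finite T" "a \<notin> T" "inj_on spoke T" "b \<notin> spoke ` T"
    using assms(1,3,4) finite_subset[OF assms(4,2)] rainbow_subset[OF _ assms(4)] inj_on_subset[OF _ assms(4)]
    unfolding distinct_spokes_def by blast+
  then have "card (insert b (spoke ` T)) = Suc (card T)" by (simp add: card_image)
  then show ?thesis using cnt_rainbow[OF T(1-3)] by (simp add: Suc_choose_two)
qed

text \<open>The spoke of \<open>v\<close> repeats a colour of the palette, so the fresh colours, at
  least \<open>card S\<close> many, all come from edges into \<open>S\<close>, which must then be
  distinct and new.\<close>

lemma constant_spokes_extend:
  assumes S: "constant_spokes c S" "finite S" "a \<notin> S" and v: "v \<notin> insert a S" "spoke v \<in> {b, c}"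
    and many: "card S \<le> card (fresh v S)"
  shows "constant_spokes c (insert v S)"
proof -
  let ?f = "\<lambda>x. \<Delta> {v, x}"
  obtain s t where s: "s \<in> S" "t \<in> S" "s \<noteq> t" "spoke s = c" "spoke t = c" and rb: "rainbow S" and sp: "spoke ` S \<subseteq> {b, c}"
    using S by (auto simp: constant_spokes_def)
  have bc: "{b, c} \<subseteq> insert b (spoke ` S)" using s by auto
  have pal: "palette S = insert b (spoke ` S) \<union> \<Delta> ` [S]\<^bsup>2\<^esup>" by (rule palette_eq[OF S(3)])
  have "spoke v = ?f a" by (simp add: spoke_def insert_commute)
  then have "fresh v S \<subseteq> ?f ` S - palette S" using v(2) bc pal by (auto simp: fresh_def star_def)
  then have "card (fresh v S) \<le> card (?f ` S - palette S)" using S by (intro card_mono) auto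
  with many have f: "inj_on ?f S" "?f ` S \<inter> palette S = {}"
    using inj_on_if_card_image_Diff[OF S(2), of ?f "palette S"] by auto
  have "spoke v \<in> insert b (spoke ` S)" using v(2) bc by blast
  then have "spoke v \<notin> ?f ` S" "spoke v \<notin> \<Delta> ` [S]\<^bsup>2\<^esup>" using f(2) pal rb unfolding rainbow_def by blast+
  then have "rainbow (insert v S)" by (intro rainbow_insert rb v S f)
  then show ?thesis using s sp v(2) unfolding constant_spokes_def by blast
qed

text \<open>Only \<open>Suc (card S)\<close> edges join \<open>v\<close> to
  \<open>insert a S\<close>, so with that many fresh colours all of them are distinct and
  new.\<close>

lemma distinct_spokes_extend:
  assumes S: "distinct_spokes S" "finite S" "a \<notin> S" and v: "v \<notin> insert a S"
    and many: "Suc (card S) \<le> card (fresh v S)"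
  shows "distinct_spokes (insert v S)"
proof -
  let ?f = "\<lambda>x. \<Delta> {v, x}"
  have pal: "palette S = insert b (spoke ` S) \<union> \<Delta> ` [S]\<^bsup>2\<^esup>" by (rule palette_eq[OF S(3)])
  have sv: "spoke v = ?f a" by (simp add: spoke_def insert_commute)
  have "inj_on ?f (insert a S) \<and> ?f ` insert a S \<inter> palette S = {}"
    using S many by (intro inj_on_if_card_image_Diff) (auto simp: fresh_def star_def)
  then have f: "inj_on ?f S" "?f a \<notin> ?f ` (S - {a})" "?f ` S \<inter> palette S = {}" "?f a \<notin> palette S"
    by (auto simp: inj_on_insert)
  have "S - {a} = S" using S by auto
  then have "spoke v \<notin> ?f ` S" "spoke v \<notin> \<Delta> ` [S]\<^bsup>2\<^esup>" using f(2,4) pal unfolding sv by simp_all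
  moreover have "rainbow S" using S(1) by (simp add: distinct_spokes_def)
  ultimately have "rainbow (insert v S)" using v S(3) f(1,3) by (intro rainbow_insert)
  then show ?thesis using S(1) f(4) v pal by (auto simp: distinct_spokes_def sv inj_on_insert)
qed

text \<open>At most one of the \<open>Suc (card S)\<close> edges from \<open>v\<close> to
  \<open>insert a S\<close> is redundant, and dropping one vertex \<open>w\<close> cures this. If
  the spoke of \<open>v\<close> is not involved, \<open>w\<close> is the endpoint of the redundant
  edge. Otherwise the colour of the spoke, being neither \<open>b\<close> nor \<open>c\<close>,
  reappears on one edge inside \<open>S\<close> or on one from \<open>v\<close> to \<open>S\<close>,
  and \<open>w\<close> is an endpoint of it in \<open>S\<close>.\<close>

lemma constant_spokes_all_fresh:
  assumes S: "constant_spokes c S" "finite S" "a \<notin> S" and v: "v \<notin> insert a S" "spoke v \<notin> {b, c}"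
    and many: "card S \<le> card (fresh v S)"
  obtains w where "w \<in> S" "\<And>T. T \<subseteq> S - {w} \<Longrightarrow> card (fresh v T) = Suc (card T)"
proof -
  let ?f = "\<lambda>x. \<Delta> {v, x}"
  obtain s where s: "s \<in> S" and rb: "rainbow S" and sp: "spoke ` S \<subseteq> {b, c}"
    using S by (auto simp: constant_spokes_def)
  have pal: "palette S = insert b (spoke ` S) \<union> \<Delta> ` [S]\<^bsup>2\<^esup>" by (rule palette_eq[OF S(3)])
  have sv: "spoke v = ?f a" by (simp add: spoke_def insert_commute)
  have "\<exists>w\<in>S. inj_on ?f (insert a (S - {w})) \<and> ?f ` insert a (S - {w}) \<inter> palette (S - {w}) = {}"
  proof (cases "?f a \<in> ?f ` S \<or> ?f a \<in> palette S")
    case False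
    then have "fresh v S = insert (?f a) (?f ` S - palette S)" by (auto simp: fresh_def star_def)
    then have "card (fresh v S) \<le> Suc (card (?f ` S - palette S))" using S(2) by (simp add: card_insert_if)
    with many have "card S \<le> Suc (card (?f ` S - palette S))" by linarith
    then obtain w where w: "w \<in> S" "inj_on ?f (S - {w})" "?f ` (S - {w}) \<inter> palette S = {}"
      using almost_inj_on_if_card_image_Diff[OF S(2)] s by blast
    have "palette (S - {w}) \<subseteq> palette S" by (intro palette_mono) auto
    with w False show ?thesis by (intro bexI[of _ w]) (auto simp: inj_on_insert)
  next
    case True
    then have "fresh v S \<subseteq> ?f ` S - palette S" by (auto simp: fresh_def star_def)
    then have "card (fresh v S) \<le> card (?f ` S - palette S)" using S by (intro card_mono) auto
    with many have f: "inj_on ?f S" "?f ` S \<inter> palette S = {}"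
      using inj_on_if_card_image_Diff[OF S(2), of ?f "palette S"] by auto
    have key: "\<exists>w\<in>S. ?f a \<notin> ?f ` (S - {w}) \<and> ?f a \<notin> palette (S - {w})"
    proof (cases "?f a \<in> palette S")
      case False
      with True obtain w where w: "w \<in> S" "?f a = ?f w" by blast
      then have "?f a \<notin> ?f ` (S - {w})" using f(1) by (auto simp: inj_on_def)
      moreover have "palette (S - {w}) \<subseteq> palette S" by (intro palette_mono) auto
      ultimately show ?thesis using w False by blast
    next
      case True
      then have "?f a \<in> \<Delta> ` [S]\<^bsup>2\<^esup>" using v(2) sp pal unfolding sv by blast
      then obtain d where d: "d \<in> [S]\<^bsup>2\<^esup>" "?f a = \<Delta> d" by blast
      then obtain x y where x: "d = {x, y}" "x \<in> S" "y \<in> S" "x \<noteq> y" using nsets2_E by metis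
      have "a \<notin> S - {x}" using S by auto
      then have pal': "palette (S - {x}) = insert b (spoke ` (S - {x})) \<union> \<Delta> ` [S - {x}]\<^bsup>2\<^esup>" by (rule palette_eq)
      have "\<Delta> d \<notin> \<Delta> ` [S - {x}]\<^bsup>2\<^esup>"
      proof
        assume "\<Delta> d \<in> \<Delta> ` [S - {x}]\<^bsup>2\<^esup>"
        then obtain d' where d': "d' \<in> [S - {x}]\<^bsup>2\<^esup>" "\<Delta> d = \<Delta> d'" by blast
        then have "d' \<in> [S]\<^bsup>2\<^esup>" using nsets_mono[of "S - {x}" S 2] by blast
        then have "d = d'" using rb d d' by (auto simp: rainbow_def inj_on_def)
        then show False using d'(1) x by (auto simp: nsets_def)
      qed
      moreover have "?f a \<notin> insert b (spoke ` (S - {x}))" using v(2) sp unfolding sv by blast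
      ultimately have "?f a \<notin> palette (S - {x})" unfolding pal' using d(2) by simp
      moreover have "?f a \<notin> ?f ` (S - {x})" using f(2) True by blast
      ultimately show ?thesis using x by blast
    qed
    then obtain w where w: "w \<in> S" "?f a \<notin> ?f ` (S - {w})" "?f a \<notin> palette (S - {w})" by blast
    have "palette (S - {w}) \<subseteq> palette S" by (intro palette_mono) auto
    then have "?f ` insert a (S - {w}) \<inter> palette (S - {w}) = {}" using f(2) w(3) by blast
    moreover have "inj_on ?f (insert a (S - {w}))"
      using inj_on_subset[OF f(1), of "S - {w}"] w(2) S by (auto simp: inj_on_insert)
    ultimately show ?thesis using w(1) by blast
  qed
  then obtain w where w: "w \<in> S" "inj_on ?f (insert a (S - {w}))" "?f ` insert a (S - {w}) \<inter> palette (S - {w}) = {}"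
    by blast
  show ?thesis
  proof (rule that[OF w(1)])
    fix T assume T: "T \<subseteq> S - {w}"
    have fT: "finite T" "a \<notin> T" using T S finite_subset by blast+
    have "fresh v T = ?f ` insert a T"
      using w(3) T palette_mono[OF T] unfolding fresh_def star_def by blast
    moreover have "inj_on ?f (insert a T)" using T by (intro inj_on_subset[OF w(2)]) auto
    ultimately show "card (fresh v T) = Suc (card T)" using fT by (simp only: card_image) simp
  qed
qed

end

section \<open>Maximal canonical sets show every colour\<close>

context few_values
begin

text \<open>The values of \<open>g\<close> at three consecutive sizes exhaust \<open>vals\<close> in
  the window, which leaves two consecutive gaps.\<close>

lemma window_gap:
  fixes g :: "nat \<Rightarrow> nat"
  assumes inc: "\<And>k. g k < g (Suc k) \<or> k < 400 * y" and slow: "\<And>k. g (Suc k) \<le> g k + Suc k"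
    and start: "\<And>k. (k choose 2) + 1 \<le> g k"
    and val: "\<And>k. 400 * y \<le> k \<Longrightarrow> k \<le> 415 * y \<Longrightarrow> g k \<in> vals"
  obtains k where "400 * y < k" "k + 2 \<le> 415 * y"
    "\<And>q. q \<in> vals \<Longrightarrow> g k < q \<Longrightarrow> g (Suc k) \<le> q"
    "\<And>q. q \<in> vals \<Longrightarrow> g (Suc k) < q \<Longrightarrow> g (Suc (Suc k)) \<le> q"
proof -
  have "\<exists>k\<ge>400 * y. k + 3 \<le> 415 * y \<and> card (vals \<inter> {g k<..g (k + 3)}) \<le> 3"
  proof (rule window)
    have "(388 * y choose 2) \<le> (400 * y choose 2)" by (intro choose_two_mono) simp
    then show "(388 * y choose 2) + 1 \<le> g (400 * y)" using start[of "400 * y"] by linarith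
    show "g k < g (Suc k)" if "400 * y \<le> k" for k using inc[of k] that by linarith
  qed (rule slow)
  then obtain k where k: "400 * y \<le> k" "k + 3 \<le> 415 * y" and c: "card (vals \<inter> {g k<..g (k + 3)}) \<le> 3" by blast
  define l where "l = Suc k"
  have k3: "k + 3 = Suc (Suc l)" by (simp add: l_def)
  have i: "g k < g l" "g l < g (Suc l)" "g (Suc l) < g (Suc (Suc l))"
    using inc[of k] inc[of l] inc[of "Suc l"] k by (auto simp: l_def)
  have in_vals: "g l \<in> vals" "g (Suc l) \<in> vals" "g (Suc (Suc l)) \<in> vals" using k by (auto intro!: val simp: l_def)
  have none: "q = g l \<or> q = g (Suc l) \<or> q = g (Suc (Suc l))" if "q \<in> vals" "g k < q" "q \<le> g (Suc (Suc l))" for q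
    by (rule eq_if_card_Int_interval_le_3[OF finite_vals c[unfolded k3] i in_vals that])
  show ?thesis
  proof (rule that[of l])
    show "400 * y < l" "l + 2 \<le> 415 * y" using k by (auto simp: l_def)
    show "g (Suc l) \<le> q" if "q \<in> vals" "g l < q" for q
      using none[OF that(1)] that i by (cases "q \<le> g (Suc (Suc l))") auto
    show "g (Suc (Suc l)) \<le> q" if "q \<in> vals" "g (Suc l) < q" for q
      using none[OF that(1)] that i by (cases "q \<le> g (Suc (Suc l))") auto
  qed
qed

text \<open>If a colour is missing, \<open>no_new_pair\<close> leaves a single vertex
  \<open>v\<close> with a new colour. Under a shortfall of at least two, adding \<open>v\<close> to
  a suitable \<open>k\<close>-set gains between 1 and \<open>k - 1\<close> colours, which falls
  inside the first gap since \<open>g (Suc k) = g k + k\<close>. Otherwise maximality forces a spoke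
  outside \<open>{b, c}\<close>, and a gain of \<open>k + 1\<close> falls inside the second
  gap.\<close>

lemma constant_spokes_maximal:
  assumes S: "constant_spokes c S" "S \<subseteq> V" "998 * y \<le> card S"
    and max: "\<And>v. v \<in> V - S \<Longrightarrow> \<not> constant_spokes c (insert v S)"
  shows "cnt S = cnt V"
proof (rule ccontr)
  assume ne: "cnt S \<noteq> cnt V"
  have fS: "finite S" and aS: "a \<notin> S" using S finite_sub sub_apex by blast+
  obtain s t where s: "s \<in> S" "spoke s = c" and t: "t \<in> S" "spoke t = c" and st: "s \<noteq> t"
    using S by (auto simp: constant_spokes_def)
  define g where "g k = (k choose 2) + card {b, c}" for k
  have cntg: "cnt T = g (card T)" if "T \<subseteq> S" "s \<in> T \<or> t \<in> T" for T
    using cnt_constant_spokes[OF S(1) fS aS that(1)] s t that(2) by (auto simp: g_def)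
  have g_Suc: "g (Suc k) = g k + k" for k by (simp add: g_def Suc_choose_two)
  have gval: "g k \<in> vals" if "400 * y \<le> k" "k \<le> 415 * y" for k
  proof -
    have "\<exists>T. {s} \<subseteq> T \<and> T \<subseteq> S \<and> card T = k"
      by (rule exists_subset_between) (use s fS that S(3) y_large in auto)
    then obtain T where T: "s \<in> T" "T \<subseteq> S" "card T = k" by auto
    then have "cnt T = g k" using cntg by blast
    moreover have "cnt T \<in> vals" using T(2) S(2) unfolding vals_def by blast
    ultimately show ?thesis by simp
  qed
  obtain k where k: "400 * y < k" "k + 2 \<le> 415 * y"
    and gap1: "\<And>q. q \<in> vals \<Longrightarrow> g k < q \<Longrightarrow> g (Suc k) \<le> q"
    and gap2: "\<And>q. q \<in> vals \<Longrightarrow> g (Suc k) < q \<Longrightarrow> g (Suc (Suc k)) \<le> q"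
  proof (rule window_gap[of g])
    show "g k < g (Suc k) \<or> k < 400 * y" for k using y_large by (auto simp: g_Suc)
    show "(k choose 2) + 1 \<le> g k" for k by (simp add: g_def card_insert_if)
  qed (auto simp: g_Suc intro: gval)
  have kS: "k + 2 \<le> card S" using k S(3) by linarith
  \<comment> \<open>Ten leaves room for \<open>s\<close>, the endpoint \<open>x\<close> and six
    witnesses; \<open>S'\<close> may lack one vertex, the \<open>w\<close> of the last case.\<close>
  have up: "\<exists>T. W \<subseteq> T \<and> T \<subseteq> S' \<and> card T = k" if "W \<subseteq> S'" "card W \<le> 10" "S' \<subseteq> S" "card S \<le> card S' + 1" for W S'
    using that k kS y_large fS finite_subset by (intro exists_subset_between) auto
  have ins: "cnt (insert v T) = g k + card (fresh v T) \<and> cnt (insert v T) \<in> vals"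
    if "v \<in> V - S" "T \<subseteq> S" "card T = k" "s \<in> T \<or> t \<in> T" for v T
  proof -
    have "cnt (insert v T) = cnt T + card (fresh v T)"
      using that fS finite_subset apex by (intro cnt_insert_fresh) auto
    moreover have "cnt T = g k" using cntg that by blast
    moreover have "insert v T \<subseteq> V" using that S by auto
    then have "cnt (insert v T) \<in> vals" unfolding vals_def by blast
    ultimately show ?thesis by simp
  qed
  from S(2) ne show False
  proof (cases rule: new_vertex_or_pair)
    case (2 v w)
    show False
    proof (rule no_new_pair[OF S(2) 2 s(1), of k])
      fix T q assume "T \<subseteq> S" "card T = k" "s \<in> T" "q \<in> vals" "cnt T < q"
      then show "cnt T + k \<le> q" using gap1[of q] cntg[of T] g_Suc by simp
    qed (use k kS y_large in auto)
  next
    case (1 v)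
    then have v: "v \<notin> insert a S" using apex by auto
    show False
    proof (cases "card (fresh v S) + 2 \<le> Suc (card S)")
      case True
      obtain W where W: "W \<subseteq> S" "card W \<le> 3 * 2"
        "\<And>T. W \<subseteq> T \<Longrightarrow> T \<subseteq> S \<Longrightarrow> card (fresh v T) + 2 \<le> Suc (card T)"
        using shortfall_witness[OF fS aS True] by blast
      obtain x where x: "x \<in> insert a S" "\<Delta> {v, x} \<notin> palette S" using 1(2) by (auto simp: star_def)
      have "card (insert s (({x} - {a}) \<union> W)) \<le> Suc (card (({x} - {a}) \<union> W))"
        using finite_subset[OF W(1) fS] by (simp add: card_insert_if)
      also have "\<dots> \<le> Suc (card ({x} - {a}) + card W)" using card_Un_le by (simp only: Suc_le_mono)
      also have "\<dots> \<le> 10" using W(2) card_mono[of "{x}" "{x} - {a}"] by simp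
      finally obtain T where T: "insert s (({x} - {a}) \<union> W) \<subseteq> T" "T \<subseteq> S" "card T = k"
        using up[of "insert s (({x} - {a}) \<union> W)" S] s x W(1) by auto
      have fT: "finite T" using T fS finite_subset by blast
      have "\<Delta> {v, x} \<in> fresh v T"
        using x(2) T palette_mono[OF T(2)] by (auto simp: fresh_def star_def)
      then have "card (fresh v T) > 0" using fT by (auto simp: card_gt_0_iff)
      moreover have "card (fresh v T) + 2 \<le> Suc k" using W(3)[of T] T by auto
      ultimately show False using ins[OF 1(1) T(2,3)] T(1) gap1[of "cnt (insert v T)"] g_Suc by auto
    next
      case False
      then have many: "card S \<le> card (fresh v S)" by linarith
      then have sv: "spoke v \<notin> {b, c}"
        using constant_spokes_extend[OF S(1) fS aS v] max[OF 1(1)] by blast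
      obtain w where w: "w \<in> S" "\<And>T. T \<subseteq> S - {w} \<Longrightarrow> card (fresh v T) = Suc (card T)"
        using constant_spokes_all_fresh[OF S(1) fS aS v sv many] by blast
      \<comment> \<open>\<open>T\<close> must contain a vertex with spoke \<open>c\<close> for its
        count to be \<open>g k\<close>; when \<open>w\<close> is \<open>s\<close>, the second
        witness \<open>t\<close> serves.\<close>
      have "\<exists>T. (if w = s then {t} else {s}) \<subseteq> T \<and> T \<subseteq> S - {w} \<and> card T = k"
        by (rule up) (use s t st w fS in \<open>auto simp: card_Diff_subset\<close>)
      then obtain T where T: "s \<in> T \<or> t \<in> T" "T \<subseteq> S - {w}" "card T = k" by (auto split: if_splits)
      have "T \<subseteq> S" using T(2) by blast
      then have "cnt (insert v T) = g k + Suc k" "cnt (insert v T) \<in> vals"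
        using ins[OF 1(1) _ T(3,1)] w(2)[OF T(2)] T(3) by auto
      then show False using gap2[of "cnt (insert v T)"] k y_large by (auto simp: g_Suc)
    qed
  qed
qed

text \<open>Here \<open>g\<close> grows by \<open>Suc k\<close>, the full number of edges from a new
  vertex to a \<open>k\<close>-set and the apex, while maximality gives \<open>v\<close> a shortfall
  of at least one. The gain is then at most \<open>k\<close>, and a single gap suffices.\<close>

lemma distinct_spokes_maximal:
  assumes S: "distinct_spokes S" "S \<subseteq> V" "998 * y \<le> card S"
    and max: "\<And>v. v \<in> V - S \<Longrightarrow> \<not> distinct_spokes (insert v S)"
  shows "cnt S = cnt V"
proof (rule ccontr)
  assume ne: "cnt S \<noteq> cnt V"
  have fS: "finite S" and aS: "a \<notin> S" using S finite_sub sub_apex by blast+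
  obtain s where s: "s \<in> S" using S(3) y_large by (cases "S = {}") auto
  define g where "g k = (Suc k choose 2) + 1" for k
  have cntg: "cnt T = g (card T)" if "T \<subseteq> S" for T
    using cnt_distinct_spokes[OF S(1) fS aS that] by (simp add: g_def)
  have g_Suc: "g (Suc k) = g k + Suc k" for k by (simp add: g_def Suc_choose_two)
  obtain k where k: "400 * y < k" "k + 2 \<le> 415 * y"
    and gap1: "\<And>q. q \<in> vals \<Longrightarrow> g k < q \<Longrightarrow> g (Suc k) \<le> q"
  proof (rule window_gap[of g])
    show "(k choose 2) + 1 \<le> g k" for k by (simp add: g_def Suc_choose_two)
    fix k assume "k \<le> 415 * y"
    then have "k \<le> card S" using S(3) by linarith
    then obtain T where "T \<subseteq> S" "card T = k" by (meson obtain_subset_with_card_n)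
    moreover from this have "T \<subseteq> V" using S(2) by blast
    then have "cnt T \<in> vals" unfolding vals_def by blast
    ultimately show "g k \<in> vals" using cntg[of T] by simp
  qed (auto simp: g_Suc)
  have kS: "k + 2 \<le> card S" using k S(3) by linarith
  from S(2) ne show False
  proof (cases rule: new_vertex_or_pair)
    case (2 v w)
    show False
    proof (rule no_new_pair[OF S(2) 2 s, of k])
      fix T q assume "T \<subseteq> S" "card T = k" "s \<in> T" "q \<in> vals" "cnt T < q"
      then show "cnt T + k \<le> q" using gap1[of q] cntg[of T] g_Suc[of k] by simp
    qed (use k kS y_large in auto)
  next
    case (1 v)
    then have v: "v \<notin> insert a S" using apex by auto
    have short: "card (fresh v S) + 1 \<le> Suc (card S)"
      using distinct_spokes_extend[OF S(1) fS aS v] max[OF 1(1)] by linarith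
    obtain W where W: "W \<subseteq> S" "card W \<le> 3 * 1"
      "\<And>T. W \<subseteq> T \<Longrightarrow> T \<subseteq> S \<Longrightarrow> card (fresh v T) + 1 \<le> Suc (card T)"
      using shortfall_witness[OF fS aS short] by blast
    obtain x where x: "x \<in> insert a S" "\<Delta> {v, x} \<notin> palette S" using 1(2) by (auto simp: star_def)
    have "\<exists>T. ({x} - {a}) \<union> W \<subseteq> T \<and> T \<subseteq> S \<and> card T = k"
    proof (rule exists_subset_between)
      have "card (({x} - {a}) \<union> W) \<le> card ({x} - {a}) + card W" by (rule card_Un_le)
      also have "\<dots> \<le> k" using W(2) card_mono[of "{x}" "{x} - {a}"] k y_large by simp
      finally show "card (({x} - {a}) \<union> W) \<le> k" .
    qed (use kS x W fS in auto)
    then obtain T where T: "({x} - {a}) \<union> W \<subseteq> T" "T \<subseteq> S" "card T = k" by blast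
    have fT: "finite T" using T fS finite_subset by blast
    have "\<Delta> {v, x} \<in> fresh v T"
      using x(2) T palette_mono[OF T(2)] by (auto simp: fresh_def star_def)
    then have pos: "card (fresh v T) > 0" using fT by (auto simp: card_gt_0_iff)
    have le: "card (fresh v T) + 1 \<le> Suc k" using W(3)[of T] T by auto
    have "cnt (insert v T) = g k + card (fresh v T)"
      using cnt_insert_fresh[OF fT, of v] v T(2) cntg[OF T(2)] T(3) by auto
    moreover have "cnt (insert v T) \<in> vals" using 1(1) T(2) S(2) unfolding vals_def by blast
    ultimately show False using gap1[of "cnt (insert v T)"] pos le g_Suc[of k] by linarith
  qed
qed

text \<open>A maximal canonical set \<open>M\<close> shows all colours, and its own count is
  exceptional: \<open>card M choose 2\<close> plus 1 or 2 for constant spokes, according to whether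
  \<open>c = b\<close>, and \<open>Suc (card M) choose 2\<close> plus 1 for distinct ones.\<close>

lemma exceptional:
  obtains i where "2 \<le> i" "cnt V = (i choose 2) + 1 \<or> cnt V = (i choose 2) + 2"
proof -
  obtain S where S: "S \<subseteq> V" "998 * y \<le> card S" "(\<exists>c. constant_spokes c S) \<or> distinct_spokes S"
    by (rule ex_canonical)
  from S(3) show ?thesis
  proof (elim disjE exE)
    fix c assume "constant_spokes c S"
    from ex_max_superset[of "constant_spokes c", OF this S(1)] obtain M where M: "constant_spokes c M" "M \<subseteq> V" "card S \<le> card M"
      "\<And>v. v \<in> V - M \<Longrightarrow> \<not> constant_spokes c (insert v M)" by blast
    have M': "998 * y \<le> card M" using M(3) S(2) by linarith
    have fM: "finite M" and aM: "a \<notin> M" using M finite_sub sub_apex by blast+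
    have "cnt M = cnt V" by (rule constant_spokes_maximal[OF M(1,2) M' M(4)])
    moreover obtain s where "s \<in> M" "spoke s = c" using M(1) by (auto simp: constant_spokes_def)
    then have "cnt M = (card M choose 2) + card {b, c}" by (intro cnt_constant_spokes[OF M(1) fM aM]) auto
    moreover have "card {b, c} = 1 \<or> card {b, c} = 2" by (cases "b = c") auto
    ultimately show ?thesis using that[of "card M"] M' y_large by auto
  next
    assume "distinct_spokes S"
    from ex_max_superset[of distinct_spokes, OF this S(1)] obtain M where M: "distinct_spokes M" "M \<subseteq> V" "card S \<le> card M"
      "\<And>v. v \<in> V - M \<Longrightarrow> \<not> distinct_spokes (insert v M)" by blast
    have M': "998 * y \<le> card M" using M(3) S(2) by linarith
    have fM: "finite M" and aM: "a \<notin> M" using M finite_sub sub_apex by blast+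
    have "cnt M = cnt V" by (rule distinct_spokes_maximal[OF M(1,2) M' M(4)])
    moreover have "cnt M = (Suc (card M) choose 2) + 1" by (intro cnt_distinct_spokes[OF M(1) fM aM]) auto
    ultimately show ?thesis using that[of "Suc (card M)"] M' y_large by auto
  qed
qed

end

subsection \<open>The infinite colouring\<close>

text \<open>Thin the infinite set once for each vertex of \<open>V\<close>, by pigeonhole on
  finitely many colours.\<close>

lemma infinite_constant_stars:
  assumes "finite V" "infinite A" "finite C" "\<And>v x. v \<in> V \<Longrightarrow> x \<in> A \<Longrightarrow> f {v, x} \<in> C"
  shows "\<exists>B. B \<subseteq> A \<and> infinite B \<and> (\<forall>v\<in>V. \<forall>x\<in>B. \<forall>x'\<in>B. f {v, x} = f {v, x'})"
  using assms
proof (induction V rule: finite_induct)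
  case empty then show ?case by blast
next
  case (insert u V)
  then obtain B where B: "B \<subseteq> A" "infinite B" "\<forall>v\<in>V. \<forall>x\<in>B. \<forall>x'\<in>B. f {v, x} = f {v, x'}" by auto
  have "(\<lambda>x. f {u, x}) ` B \<subseteq> C" using insert.prems B by auto
  then have "finite ((\<lambda>x. f {u, x}) ` B)" using insert.prems finite_subset by blast
  then obtain x0 where x0: "x0 \<in> B" "infinite {x \<in> B. f {u, x} = f {u, x0}}"
    using pigeonhole_infinite[OF B(2)] by blast
  let ?B = "{x \<in> B. f {u, x} = f {u, x0}}"
  have "f {v, x} = f {v, x'}" if "v \<in> insert u V" "x \<in> ?B" "x' \<in> ?B" for v x x'
  proof (cases "v = u")
    case True
    then show ?thesis using that(2,3) by simp
  next
    case False
    then show ?thesis using that B(3) by blast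
  qed
  moreover have "?B \<subseteq> A" using B(1) by blast
  ultimately show ?case using x0(2) by blast
qed

text \<open>Towards \<open>V\<close> every vertex of \<open>A\<close> looks like the apex, and edges
  inside \<open>A\<close> contribute only \<open>b\<close>.\<close>

lemma (in pointed_colouring) palette_eq_infinite:
  assumes a: "a \<in> A" and A: "infinite A" "\<And>x y. x \<in> A \<Longrightarrow> y \<in> A \<Longrightarrow> x \<noteq> y \<Longrightarrow> \<Delta> {x, y} = b"
    and stars: "\<And>v x. v \<in> V \<Longrightarrow> x \<in> A \<Longrightarrow> \<Delta> {v, x} = \<Delta> {v, a}" and T: "T \<subseteq> V"
  shows "palette T = \<Delta> ` [T \<union> A]\<^bsup>2\<^esup>"
proof
  have "infinite (A - {a})" using A(1) by simp
  then obtain a' where "a' \<in> A" "a' \<noteq> a" by (metis Diff_iff finite.emptyI ex_in_conv singletonI)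
  then have "b = \<Delta> {a, a'}" "{a, a'} \<in> [T \<union> A]\<^bsup>2\<^esup>" using A(2) a by auto
  then have "b \<in> \<Delta> ` [T \<union> A]\<^bsup>2\<^esup>" by (rule image_eqI)
  moreover have "[insert a T]\<^bsup>2\<^esup> \<subseteq> [T \<union> A]\<^bsup>2\<^esup>" using a by (intro nsets_mono) auto
  ultimately show "palette T \<subseteq> \<Delta> ` [T \<union> A]\<^bsup>2\<^esup>" unfolding palette_def by blast
  show "\<Delta> ` [T \<union> A]\<^bsup>2\<^esup> \<subseteq> palette T"
  proof
    fix c assume "c \<in> \<Delta> ` [T \<union> A]\<^bsup>2\<^esup>"
    then obtain d where d: "d \<in> [T \<union> A]\<^bsup>2\<^esup>" "c = \<Delta> d" by blast
    then obtain x z where xz: "d = {x, z}" "x \<in> T \<union> A" "z \<in> T \<union> A" "x \<noteq> z" using nsets2_E by metis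
    have star: "\<Delta> {v, x} \<in> palette T" if "v \<in> T" "x \<in> A" for v x
    proof -
      have "\<Delta> {v, x} = \<Delta> {v, a}" using that T by (intro stars) auto
      also have "\<dots> \<in> palette T" using that T apex by (intro palette_edge) auto
      finally show ?thesis .
    qed
    consider "x \<in> T" "z \<in> T" | "x \<in> T" "z \<in> A" | "x \<in> A" "z \<in> T" | "x \<in> A" "z \<in> A" using xz by blast
    then show "c \<in> palette T"
    proof cases
      case 1 then show ?thesis unfolding d(2) xz(1) using xz(4) by (intro palette_edge) auto
    next
      case 2 then show ?thesis unfolding d(2) xz(1) by (rule star)
    next
      case 3 then show ?thesis unfolding d(2) xz(1) using star[of z x] by (simp add: insert_commute)
    next
      case 4 then show ?thesis unfolding d(2) xz(1) using A(2) xz(4) base_in_palette by simp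
    qed
  qed
qed

lemma pointed_colouring_of_colouring:
  assumes col: "colouring m \<Delta>"
  obtains b a V where "pointed_colouring a V" "pointed_colouring.cnt \<Delta> b a V = m"
    "pointed_colouring.vals \<Delta> b a V \<subseteq> colour_counts \<Delta>"
proof -
  have "\<exists>e. e \<in> [UNIV]\<^bsup>2\<^esup> \<and> \<Delta> e = i" if "i \<in> {1..m}" for i
  proof -
    have "i \<in> \<Delta> ` [UNIV]\<^bsup>2\<^esup>" using that col by (simp add: colouring_def)
    then obtain e where "i = \<Delta> e" "e \<in> [UNIV]\<^bsup>2\<^esup>" by (rule imageE)
    then show ?thesis by blast
  qed
  then obtain e where e: "\<And>i. i \<in> {1..m} \<Longrightarrow> e i \<in> [UNIV]\<^bsup>2\<^esup>" "\<And>i. i \<in> {1..m} \<Longrightarrow> \<Delta> (e i) = i" by metis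
  \<comment> \<open>One edge of each colour, so that the finite set \<open>V\<close> already shows
    all of them.\<close>
  define V where "V = (\<Union>i\<in>{1..m}. e i)"
  have fV: "finite V" unfolding V_def using e(1) by (auto simp: nsets_def)
  have inC: "\<Delta> {x, y} \<in> {1..m}" if "x \<noteq> y" for x y
    using col that unfolding colouring_def by (metis UNIV_I doubleton_in_nsets_2 imageI)
  have "infinite (- V)" using fV by (simp add: finite_compl)
  then have "\<exists>B. B \<subseteq> - V \<and> infinite B \<and> (\<forall>v\<in>V. \<forall>x\<in>B. \<forall>x'\<in>B. \<Delta> {v, x} = \<Delta> {v, x'})"
  proof (rule infinite_constant_stars[OF fV _ finite_atLeastAtMost])
    show "\<Delta> {v, x} \<in> {1..m}" if "v \<in> V" "x \<in> - V" for v x using that by (intro inC) blast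
  qed
  then obtain B where B: "B \<subseteq> - V" "infinite B" "\<And>v x x'. v \<in> V \<Longrightarrow> x \<in> B \<Longrightarrow> x' \<in> B \<Longrightarrow> \<Delta> {v, x} = \<Delta> {v, x'}"
    by blast
  have "\<forall>x\<in>B. \<forall>y\<in>B. x \<noteq> y \<longrightarrow> \<Delta> {x, y} < Suc m" using inC by (auto simp: less_Suc_eq_le)
  from Ramsey2[OF B(2) this] obtain A b where "A \<subseteq> B \<and> infinite A \<and> b < Suc m \<and> (\<forall>x\<in>A. \<forall>y\<in>A. x \<noteq> y \<longrightarrow> \<Delta> {x, y} = b)"
    by (elim exE)
  then have A: "A \<subseteq> B" "infinite A" "\<And>x y. x \<in> A \<Longrightarrow> y \<in> A \<Longrightarrow> x \<noteq> y \<Longrightarrow> \<Delta> {x, y} = b"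
    by simp_all
  obtain a where a: "a \<in> A" using A(2) by (metis finite.emptyI ex_in_conv)
  have aV: "a \<notin> V" using a A B by auto
  have P: "pointed_colouring a V" by unfold_locales (use fV aV in auto)
  have stars: "\<Delta> {v, x} = \<Delta> {v, a}" if "v \<in> V" "x \<in> A" for v x using that A(1) a by (intro B(3)) auto
  let ?cnt = "pointed_colouring.cnt \<Delta> b a" and ?palette = "pointed_colouring.palette \<Delta> b a"
  have pal: "?palette T = \<Delta> ` [T \<union> A]\<^bsup>2\<^esup>" if "T \<subseteq> V" for T
    by (rule pointed_colouring.palette_eq_infinite[OF P a A(2) _ _ that]) (fact A(3), fact stars)
  have cnt: "?cnt T = num_colours \<Delta> (T \<union> A)" if "T \<subseteq> V" for T
    using pal[OF that] by (simp add: pointed_colouring.cnt_def[OF P] num_colours_def)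
  have "?palette V = {1..m}"
  proof
    show "?palette V \<subseteq> {1..m}"
      using pal[of V] col nsets_mono[of "V \<union> A" UNIV 2] unfolding colouring_def by blast
    show "{1..m} \<subseteq> ?palette V"
    proof
      fix i assume i: "i \<in> {1..m}"
      have "e i \<in> [insert a V]\<^bsup>2\<^esup>" using e(1)[OF i] i by (auto simp: nsets_def V_def)
      then have "\<Delta> (e i) \<in> ?palette V" unfolding pointed_colouring.palette_def[OF P] by blast
      then show "i \<in> ?palette V" using e(2)[OF i] by simp
    qed
  qed
  then have "?cnt V = m" by (simp add: pointed_colouring.cnt_def[OF P])
  moreover have "pointed_colouring.vals \<Delta> b a V \<subseteq> colour_counts \<Delta>"
    unfolding pointed_colouring.vals_def[OF P] colour_counts_def using cnt A(2) by (auto intro!: exI[of _ "_ \<union> A"])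
  ultimately show ?thesis using that P by blast
qed

section \<open>The numerical conclusion\<close>

lemma psi_attained:
  assumes "m \<ge> 1" obtains \<Delta> where "colouring m \<Delta>" "psi m = card (colour_counts \<Delta>)"
proof -
  have "psi m \<in> {card (colour_counts \<Delta>) |\<Delta>. colouring m \<Delta>}"
    unfolding psi_def using finite_psi_candidates ex_colouring[OF assms] by (intro Min_in) auto
  then show ?thesis using that by blast
qed

text \<open>For \<open>n\<close> below \<open>10 ^ 8\<close> the value \<open>cnt {} = 1\<close>,
  which lies below all binomial intervals, gives \<open>n + 1\<close> values, and the extra
  \<open>1 / 2\<close> absorbs the factor. For larger \<open>n\<close> the failure of
  \<open>few_values\<close> gives at least \<open>n + y / 1100 - 2\<close> values, with
  \<open>y\<close> about \<open>n / 1000\<close>.\<close>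

lemma (in pointed_colouring) card_vals_large:
  assumes m: "(n choose 2) + 2 \<le> cnt V" "cnt V \<le> (Suc n choose 2)"
    and nonexc: "\<And>i. 2 \<le> i \<Longrightarrow> cnt V \<noteq> (i choose 2) + 1 \<and> cnt V \<noteq> (i choose 2) + 2"
  shows "(1 + 1 / 10 ^ 9) * (real n + 1 / 2) \<le> real (card vals)"
proof (cases "n < 10 ^ 8")
  case True
  obtain x where x: "\<And>i. 1 \<le> i \<Longrightarrow> i \<le> n \<Longrightarrow> x i \<in> vals"
    "\<And>i. 1 \<le> i \<Longrightarrow> i \<le> n \<Longrightarrow> (i choose 2) + 2 \<le> x i" "inj_on x {1..n}"
    by (rule bucket_choice[OF m(1)]) blast
  have "1 \<in> vals" using cnt_empty by (force simp: vals_def)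
  moreover have "1 \<notin> x ` {1..n}" using x(2) by fastforce
  moreover have "card (x ` {1..n}) = n" using x(3) by (simp add: card_image)
  ultimately have "card (insert 1 (x ` {1..n})) = n + 1" by simp
  moreover have "card (insert 1 (x ` {1..n})) \<le> card vals"
    using \<open>1 \<in> vals\<close> x(1) finite_vals by (intro card_mono) auto
  ultimately have "real n + 1 \<le> real (card vals)" by simp
  moreover have "real n < 10 ^ 8" using True by (metis of_nat_less_iff of_nat_numeral of_nat_power)
  ultimately show ?thesis by (simp add: field_simps)
next
  case False
  define y where "y = n div 1000"
  have y: "1000 * y \<le> n" "n < 1000 * y + 1000" by (auto simp: y_def)
  have "\<not> few_values \<Delta> b a V n y"
  proof
    assume "few_values \<Delta> b a V n y"
    then show False by (rule few_values.exceptional) (use nonexc in blast)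
  qed
  moreover have "y \<ge> 1000" using False y by simp
  ultimately have "1100 * n + y \<le> 1100 * (card vals + 2)"
    using y m by (auto simp: few_values_def few_values_axioms_def pointed_colouring_axioms not_less)
  then have "real (1100 * n + y) \<le> real (1100 * (card vals + 2))" by (simp only: of_nat_le_iff)
  moreover have "real n < 1000 * real y + 1000" using y(2) by linarith
  moreover have "real n \<ge> 10 ^ 8" using False by simp
  ultimately show ?thesis by (simp add: field_simps)
qed

theorem theorem1p4:
  shows "\<exists>\<alpha>::real. \<alpha> > 0 \<and>
    (\<forall>m::nat. m \<ge> 2 \<longrightarrow>
       m \<notin> (\<Union>n\<in>{2::nat..}. {(n choose 2) + 1, (n choose 2) + 2}) \<longrightarrow>
       real (psi m) \<ge> (1 + \<alpha>) * sqrt (2 * real m))"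
proof (intro exI[of _ "1 / 10 ^ 9"] conjI allI impI)
  fix m :: nat
  assume m: "m \<ge> 2" and "m \<notin> (\<Union>n\<in>{2::nat..}. {(n choose 2) + 1, (n choose 2) + 2})"
  then have nonexc: "m \<noteq> (i choose 2) + 1 \<and> m \<noteq> (i choose 2) + 2" if "2 \<le> i" for i using that by auto
  let ?P = "\<lambda>n. (n choose 2) + 2 \<le> m"
  define n where "n = (GREATEST n. ?P n)"
  have bound: "k \<le> Suc m" if "(k choose 2) + 2 \<le> m" for k
  proof (rule ccontr)
    assume "\<not> ?thesis"
    then have "Suc (Suc m) choose 2 \<le> k choose 2" by (intro choose_two_mono) simp
    then show False using that Suc_choose_two[of "Suc m"] by simp
  qed
  have one: "(1 choose 2) + 2 \<le> m" using m by (simp add: numeral_2_eq_2)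
  have n: "(n choose 2) + 2 \<le> m"
    unfolding n_def by (rule GreatestI_nat[of ?P 1 "Suc m", OF one]) (rule bound)
  have n1: "1 \<le> n" unfolding n_def by (rule Greatest_le_nat[of ?P 1 "Suc m", OF one]) (rule bound)
  have "\<not> (Suc n choose 2) + 2 \<le> m"
  proof
    assume "(Suc n choose 2) + 2 \<le> m"
    then have "Suc n \<le> n" unfolding n_def by (rule Greatest_le_nat[of ?P _ "Suc m"]) (rule bound)
    then show False by simp
  qed
  \<comment> \<open>Maximality of \<open>n\<close> would still allow
    \<open>m = (Suc n choose 2) + 1\<close>, which is excluded. Hence
    \<open>2 * m \<le> n * (n + 1)\<close>, and the square root is at most
    \<open>n + 1 / 2\<close>.\<close>
  then have up: "m \<le> (Suc n choose 2)" using nonexc[of "Suc n"] n1 by linarith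
  obtain \<Delta> where D: "colouring m \<Delta>" "psi m = card (colour_counts \<Delta>)"
    using psi_attained[of m] m by auto
  obtain b a V where V: "pointed_colouring a V" "pointed_colouring.cnt \<Delta> b a V = m"
    "pointed_colouring.vals \<Delta> b a V \<subseteq> colour_counts \<Delta>"
    by (rule pointed_colouring_of_colouring[OF D(1)])
  let ?vals = "pointed_colouring.vals \<Delta> b a V"
  have "2 * m \<le> Suc n * n" using up double_choose_two[of "Suc n"] by simp
  then have "real (2 * m) \<le> real (Suc n * n)" by (simp only: of_nat_le_iff)
  then have "2 * real m \<le> (real n + 1 / 2)\<^sup>2" by (simp add: power2_eq_square algebra_simps)
  then have "sqrt (2 * real m) \<le> real n + 1 / 2" by (intro real_le_lsqrt) auto
  then have "(1 + 1 / 10 ^ 9) * sqrt (2 * real m) \<le> (1 + 1 / 10 ^ 9) * (real n + 1 / 2)"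
    by (intro mult_left_mono) auto
  also have "\<dots> \<le> real (card ?vals)" using n up nonexc V(2) by (intro pointed_colouring.card_vals_large[OF V(1)]) auto
  also have "\<dots> \<le> real (card (colour_counts \<Delta>))"
    using card_mono[OF finite_subset[OF colour_counts_subset[OF D(1)]] V(3)] by simp
  finally show "real (psi m) \<ge> (1 + 1 / 10 ^ 9) * sqrt (2 * real m)" using D(2) by simp
qed simp

end
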